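(* Let $M(\mathbb{Z}_p)=\{(x,q)\in M: x,q\in\mathbb{Z}_p\}$. Then $$M(\mathbb{Z}_p)\ne\varnothing\iff p=3.$$ For $p=3$, the elements $x\in\mathbb{Z}_3$ that are nontrivial fixed points of some $[X]_q$ (i.e. such that $(x,q)\in M$ for some $q$) form the set $\phi_1(M(\mathbb{Z}_3))=B(1,1)\cup B(0,1)$, and there is an analytic bijection $x\mapsto Q(x)$, with $(x,Q(x))\in M(\mathbb{Z}_3)$ for all $x$, which maps $$B(1,1)\longrightarrow B(4,3^{-1}),\qquad B(0,1)\longrightarrow B(7,3^{-1})$$ bijectively, and satisfies $|Q(x')-Q(x)|=|x'-x|/3$ for all $x,x'\in B(1,1)\cup B(0,1)$. Here the four balls $B(1,1),B(0,1),B(4,3^{-1}),B(7,3^{-1})$ are balls in $\mathbb{Z}_3$, i.e. $B(a,r)=\{b\in\mathbb{Z}_3:|b-a|<r\}$.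
   Context: Let $p$ be a prime, $\mathbb{C}_p$ the $p$-adic complex numbers with absolute value $|\cdot|$ and additive valuation $v$, $|x|=p^{-v(x)}$, $v(p)=1$. Let $O_p=\{x\in\mathbb{C}_p:|x|\le 1\}$, and let $B(1,p^{-1/(p-1)})=\{b\in\mathbb{C}_p:|b-1|<p^{-1/(p-1)}\}$. For $x\in O_p$ and $q\in B(1,p^{-1/(p-1)})$ put $q^x=\exp(x\log q)$ ($p$-adic $\exp$ and $\log$), and define the $q$-bracket by $[x]_q=\frac{q^x-1}{q-1}$ if $q\ne 1$ and $[x]_1=x$. The equation $[x]_q=x$ has the trivial solutions $q=1$, $x=0$, $x=1$. To remove them, let $g(X,Q)=\frac{[X]_Q-X}{(Q-1)X(X-1)}$, understood as the analytic function on $O_p\times B(1,p^{-1/(p-1)})$ given by the convergent series $g(X,Q)=\sum_{n\ge 0}\frac{A_n(X)}{(n+2)!}(Q-1)^n$, where $A_0(X)=1$ and $A_n(X)=(X-2)(X-3)\cdots(X-(n+1))$ for $n>0$. Define $M=\{(x,q)\in O_p\times B(1,p^{-1/(p-1)}): g(x,q)=0\}$; $x$ is called a nontrivial fixed point of $[X]_q$ if $(x,q)\in M$. Let $\phi_1:M\to O_p$ be the projection $(x,q)\mapsto x$. *)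

theory Defs
  imports "HOL-Analysis.Analysis" "HOL-Computational_Algebra.Polynomial"
begin

text \<open>
  The library's normed fields are vector spaces over the reals, so a p-adic absolute value is not
  an instance of \<open>norm\<close>. The class below ties an absolute value \<open>vabs\<close> to the distance of a complete
  metric space, so that sums, limits and closures are the library's. Definiteness of \<open>vabs\<close>
  follows from the metric space axioms.
\<close>

class complete_nonarch_field = field_char_0 + complete_space +
  fixes vabs :: "'a \<Rightarrow> real"
  assumes dist_vabs: "dist x y = vabs (x - y)"
    and vabs_mult: "vabs (x * y) = vabs x * vabs y"
    and vabs_add: "vabs (x + y) \<le> max (vabs x) (vabs y)"

definition Qp :: "'a::complete_nonarch_field set" where
  "Qp = closure \<rat>"

definition Zp :: "'a::complete_nonarch_field set" where
  "Zp = {x \<in> Qp. vabs x \<le> 1}"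

definition Qp_bar :: "'a::complete_nonarch_field set" where
  "Qp_bar = {x. \<exists>f. f \<noteq> 0 \<and> (\<forall>i. coeff f i \<in> Qp) \<and> poly f x = 0}"

text \<open>
  The type \<open>'a\<close> is a copy of the p-adic complex numbers with their absolute value. The condition
  on \<open>vabs (of_nat p)\<close> forces \<open>vabs\<close> to be the normalised p-adic absolute value on the rationals,
  so that \<open>Qp\<close>, their closure in a complete field, is the field of p-adic numbers. The next
  condition makes \<open>Qp_bar\<close> an algebraic closure of \<open>Qp\<close>, and the last one makes \<open>'a\<close>,
  which is complete by its class, the completion of that algebraic closure.
\<close>

definition padic_complex :: "nat \<Rightarrow> 'a::complete_nonarch_field itself \<Rightarrow> bool" where
  "padic_complex p T \<longleftrightarrow>
     prime p \<and>
     vabs (of_nat p :: 'a) = 1 / real p \<and>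
     (\<forall>f :: 'a poly. (\<forall>i. coeff f i \<in> Qp_bar) \<and> degree f > 0 \<longrightarrow> (\<exists>x\<in>Qp_bar. poly f x = 0)) \<and>
     closure (Qp_bar :: 'a set) = UNIV"

definition A :: "nat \<Rightarrow> 'a::complete_nonarch_field \<Rightarrow> 'a" where
  "A n x = (\<Prod>k=2..n+1. x - of_nat k)"

text \<open>
  The analytic continuation of \<open>([x]\<^sub>q - x) / ((q - 1) * x * (x - 1))\<close>, where
  \<open>[x]\<^sub>q = (q\<^sup>x - 1) / (q - 1)\<close> is the q-bracket: it comes from the binomial series
  \<open>q\<^sup>x = (\<Sum>n. (x gchoose n) * (q - 1) ^ n)\<close> by removing its first two terms and dividing by
  \<open>(q - 1)\<^sup>2 * x * (x - 1)\<close>.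
\<close>

definition g :: "'a::complete_nonarch_field \<Rightarrow> 'a \<Rightarrow> 'a" where
  "g x q = (\<Sum>n. A n x / fact (n + 2) * (q - 1) ^ n)"

definition M :: "nat \<Rightarrow> ('a::complete_nonarch_field \<times> 'a) set" where
  "M p = {(x, q). vabs x \<le> 1 \<and> vabs (q - 1) < real p powr (- 1 / (real p - 1)) \<and> g x q = 0}"

definition M_Zp :: "nat \<Rightarrow> ('a::complete_nonarch_field \<times> 'a) set" where
  "M_Zp p = {(x, q) \<in> M p. x \<in> Zp \<and> q \<in> Zp}"

definition nontrivial_fixed_point :: "nat \<Rightarrow> 'a::complete_nonarch_field \<Rightarrow> 'a \<Rightarrow> bool" where
  "nontrivial_fixed_point p q x \<longleftrightarrow> (x, q) \<in> M p"

definition Zp_ball :: "'a::complete_nonarch_field \<Rightarrow> real \<Rightarrow> 'a set" where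
  "Zp_ball a r = {b \<in> Zp. vabs (b - a) < r}"

text \<open>
  Analyticity on a ball: one power series represents the function on the whole ball. In the
  non-archimedean setting the choice of centre is immaterial, and this is stronger than having
  a power series expansion near each point.
\<close>

definition analytic_on_Zp_ball :: "('a::complete_nonarch_field \<Rightarrow> 'a) \<Rightarrow> 'a \<Rightarrow> real \<Rightarrow> bool" where
  "analytic_on_Zp_ball f a r \<longleftrightarrow>
     (\<exists>c. (\<forall>n. c n \<in> Qp) \<and> (\<forall>x\<in>Zp_ball a r. (\<lambda>n. c n * (x - a) ^ n) sums f x))"

end

theory Submission
  imports Defs
begin

text \<open>
  Write \<open>q = 1 + t\<close>. The term of index \<open>n\<close> of the series \<open>g x (1 + t)\<close> is the binomial coefficient
  of \<open>x - 2\<close> over \<open>n\<close> times \<open>t ^ n / ((n + 1) * (n + 2))\<close>. Binomial coefficients of p-adic integers are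
  integral because the natural numbers are dense in \<open>Zp\<close>, so only the prime factors of
  \<open>(n + 1) * (n + 2)\<close> can make a term large. The term of index 0 is \<open>1 / 2\<close>. For \<open>p \<noteq> 3\<close> and \<open>q\<close> in
  \<open>Zp\<close> it strictly dominates all others, and there is no zero (\<open>M_Zp_empty\<close>). For \<open>p = 3\<close> the term
  \<open>(x - 2) * t / 6\<close> can compete with it, but not if \<open>x\<close> is congruent to 2 modulo 3
  (\<open>g_nonzero_residue_2\<close>).

  Let \<open>p = 3\<close> and \<open>t = 3 * s\<close>. Then \<open>2 * g x (1 + 3 * s) = 1 + (x - 2) * s + R x s\<close>, where all coefficients
  of \<open>R\<close> are divisible by 3 by Legendre's bound for factorials. So \<open>R\<close> shrinks distances by a factor 3
  (\<open>R_lipschitz\<close>), and the zeros form a small perturbation of the hyperbola \<open>(x - 2) * s = - 1\<close>. As on that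
  hyperbola, each 3-adic unit \<open>s\<close> belongs to exactly one \<open>x\<close>, each \<open>x\<close> with \<open>x - 2\<close> a unit belongs to
  exactly one \<open>s\<close>, and the correspondence is an isometry (\<open>exists_x\<close>, \<open>exists_s\<close>,
  \<open>zeros_isometric\<close>). Modulo 3 it sends \<open>x = 1\<close> to \<open>s = 1\<close> and \<open>x = 0\<close> to \<open>s = 2\<close>, so
  \<open>Q x = 1 + 3 * s\<close> maps the balls around 1 and 0 onto those around 4 and 7 and divides distances by 3.

  On each residue class \<open>s\<close> is a fixed point of a contraction whose coefficients are polynomials in the
  parameter. Iteration on polynomials converges in the Gauss norm, and the limit is a power series that
  represents \<open>s\<close> on the whole ball (\<open>analytic_fixed_point\<close>).
\<close>

section \<open>Ultrametric calculus\<close>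

lemma vabs_zero [simp]: "vabs (0 :: 'a::complete_nonarch_field) = 0"
  using dist_vabs[of "0 :: 'a" 0] by simp

lemma vabs_nonneg [simp]: "vabs (x :: 'a::complete_nonarch_field) \<ge> 0"
  using dist_vabs[of x 0] zero_le_dist[of x 0] by simp

lemma vabs_eq_0_iff [simp]: "vabs (x :: 'a::complete_nonarch_field) = 0 \<longleftrightarrow> x = 0"
  using dist_vabs[of x 0] dist_eq_0_iff[of x 0] by simp

lemma vabs_pos_iff: "0 < vabs (x :: 'a::complete_nonarch_field) \<longleftrightarrow> x \<noteq> 0"
  by (simp add: less_le)

lemma vabs_minus_commute: "vabs (x - y) = vabs (y - x :: 'a::complete_nonarch_field)"
  by (metis dist_vabs dist_commute)

lemma vabs_minus [simp]: "vabs (- x :: 'a::complete_nonarch_field) = vabs x"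
  using vabs_minus_commute[of 0 x] by simp

lemma vabs_one [simp]: "vabs (1 :: 'a::complete_nonarch_field) = 1"
  using vabs_mult[of "1 :: 'a" 1] by auto

lemma vabs_power: "vabs (x ^ n :: 'a::complete_nonarch_field) = vabs x ^ n"
  by (induction n) (simp_all add: vabs_mult)

lemma vabs_prod: "vabs (prod f S :: 'a::complete_nonarch_field) = (\<Prod>i\<in>S. vabs (f i))"
  by (induction S rule: infinite_finite_induct) (simp_all add: vabs_mult)

lemma vabs_inverse: "vabs (inverse x :: 'a::complete_nonarch_field) = inverse (vabs x)"
  using vabs_mult[of x "inverse x"] by (cases "x = 0") (simp_all add: field_simps)

lemma vabs_divide: "vabs (x / y :: 'a::complete_nonarch_field) = vabs x / vabs y"
  by (simp add: divide_inverse vabs_mult vabs_inverse)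

lemma vabs_add_le:
  "vabs (x :: 'a::complete_nonarch_field) \<le> r \<Longrightarrow> vabs y \<le> r \<Longrightarrow> vabs (x + y) \<le> r"
  using vabs_add[of x y] by linarith

lemma vabs_diff_le:
  "vabs (x :: 'a::complete_nonarch_field) \<le> r \<Longrightarrow> vabs y \<le> r \<Longrightarrow> vabs (x - y) \<le> r"
  using vabs_add_le[of x r "- y"] by simp

lemma vabs_add_less:
  "vabs (x :: 'a::complete_nonarch_field) < r \<Longrightarrow> vabs y < r \<Longrightarrow> vabs (x + y) < r"
  using vabs_add[of x y] by linarith

lemma vabs_diff_less:
  "vabs (x :: 'a::complete_nonarch_field) < r \<Longrightarrow> vabs y < r \<Longrightarrow> vabs (x - y) < r"
  using vabs_add_less[of x r "- y"] by simp

text \<open>In an ultrametric triangle the two longest sides are equal.\<close>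

lemma vabs_eq_of_close:
  "vabs (x - y) < vabs y \<Longrightarrow> vabs (x :: 'a::complete_nonarch_field) = vabs y"
  using vabs_add[of "x - y" y] vabs_add[of "y - x" x] vabs_minus_commute[of x y] by auto

lemma vabs_sum_le:
  assumes "\<And>i. i \<in> S \<Longrightarrow> vabs (f i :: 'a::complete_nonarch_field) \<le> r" "0 \<le> r"
  shows "vabs (sum f S) \<le> r"
  using assms by (induction S rule: infinite_finite_induct) (auto intro: vabs_add_le)

lemma vabs_sum_less:
  assumes "\<And>i. i \<in> S \<Longrightarrow> vabs (f i :: 'a::complete_nonarch_field) < r" "0 < r"
  shows "vabs (sum f S) < r"
  using assms by (induction S rule: infinite_finite_induct) (auto intro: vabs_add_less)

lemma vabs_mult_le:
  "vabs (x :: 'a::complete_nonarch_field) \<le> r \<Longrightarrow> vabs y \<le> s \<Longrightarrow> vabs (x * y) \<le> r * s"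
  using vabs_nonneg[of x] vabs_nonneg[of y] unfolding vabs_mult by (intro mult_mono) linarith+

lemma vabs_mult_le1:
  "vabs (x :: 'a::complete_nonarch_field) \<le> r \<Longrightarrow> vabs y \<le> 1 \<Longrightarrow> vabs (x * y) \<le> r"
  using vabs_mult_le[of x r y 1] by simp

text \<open>Integral factors can be exchanged one at a time, so products of integral elements, and with
  them powers and the polynomials \<open>A n\<close>, are 1-Lipschitz.\<close>

lemma vabs_mult_diff_le:
  assumes "vabs (x' :: 'a::complete_nonarch_field) \<le> 1" "vabs y \<le> 1"
    and "vabs (x - x') \<le> d" "vabs (y - y') \<le> d"
  shows "vabs (x * y - x' * y') \<le> d"
proof -
  have "x * y - x' * y' = (x - x') * y + (y - y') * x'"
    by (simp add: algebra_simps)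
  then show ?thesis
    using assms by (auto intro!: vabs_add_le vabs_mult_le1)
qed

lemma vabs_prod_le1:
  assumes "\<And>i. i \<in> S \<Longrightarrow> vabs (f i :: 'a::complete_nonarch_field) \<le> 1"
  shows "vabs (prod f S) \<le> 1"
  unfolding vabs_prod using assms by (intro prod_le_1) auto

lemma vabs_prod_diff_le:
  assumes "\<And>i. i \<in> S \<Longrightarrow> vabs (f i :: 'a::complete_nonarch_field) \<le> 1"
    and "\<And>i. i \<in> S \<Longrightarrow> vabs (h i) \<le> 1"
    and "\<And>i. i \<in> S \<Longrightarrow> vabs (f i - h i) \<le> d" and "0 \<le> d"
  shows "vabs (prod f S - prod h S) \<le> d"
  using assms
proof (induction S rule: infinite_finite_induct)
  case (insert i S)
  then show ?case
    by (auto intro!: vabs_mult_diff_le vabs_prod_le1)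
qed auto

lemma vabs_power_le1: "vabs (x :: 'a::complete_nonarch_field) \<le> 1 \<Longrightarrow> vabs (x ^ n) \<le> 1"
  by (simp add: vabs_power power_le_one)

lemma vabs_power_diff_le:
  assumes "vabs (x :: 'a::complete_nonarch_field) \<le> 1" "vabs y \<le> 1"
  shows "vabs (x ^ n - y ^ n) \<le> vabs (x - y)"
  using vabs_prod_diff_le[of "{..<n}" "\<lambda>_. x" "\<lambda>_. y" "vabs (x - y)"] assms by simp

section \<open>Limits and series\<close>

lemma tendsto_vabs_iff:
  "(f \<longlongrightarrow> (l :: 'a::complete_nonarch_field)) F \<longleftrightarrow> ((\<lambda>x. vabs (f x - l)) \<longlongrightarrow> 0) F"
  by (subst tendsto_dist_iff) (simp add: dist_vabs)

lemma tendsto_vabs_bound: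
  assumes "\<And>x. vabs (f x - (l :: 'a::complete_nonarch_field)) \<le> e x" "(e \<longlongrightarrow> 0) F"
  shows "(f \<longlongrightarrow> l) F"
  unfolding tendsto_vabs_iff
  by (rule tendsto_sandwich[OF _ _ tendsto_const assms(2)]) (use assms(1) in auto)

text \<open>These instances make the general limit rules for sums, products and series available.\<close>

instance complete_nonarch_field \<subseteq> topological_ab_group_add
proof
  fix a b :: 'a
  have 0: "((\<lambda>x. dist (fst x) a + dist (snd x) b) \<longlongrightarrow> 0) (nhds a \<times>\<^sub>F nhds b)"
    by (rule tendsto_eq_intros filterlim_fst filterlim_snd refl | simp)+
  show "((\<lambda>x. fst x + snd x) \<longlongrightarrow> a + b) (nhds a \<times>\<^sub>F nhds b)"
  proof (rule tendsto_vabs_bound[OF _ 0])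
    fix x :: "'a \<times> 'a"
    have "fst x + snd x - (a + b) = (fst x - a) + (snd x - b)" by simp
    then show "vabs (fst x + snd x - (a + b)) \<le> dist (fst x) a + dist (snd x) b"
      by (simp only: dist_vabs) (rule vabs_add_le, simp_all)
  qed
  show "(uminus \<longlongrightarrow> - a) (nhds a)"
  proof (rule tendsto_vabs_bound)
    show "vabs (- x - - a) \<le> dist x a" for x
      by (simp add: dist_vabs vabs_minus_commute)
    show "((\<lambda>x. dist x a) \<longlongrightarrow> 0) (nhds a)"
      by (rule tendsto_eq_intros filterlim_ident refl | simp)+
  qed
qed

instance complete_nonarch_field \<subseteq> topological_comm_monoid_mult
proof
  fix a b :: 'a
  have 0: "((\<lambda>x. dist (fst x) a * dist (snd x) b + dist (fst x) a * vabs b + vabs a * dist (snd x) b)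
      \<longlongrightarrow> 0) (nhds a \<times>\<^sub>F nhds b)"
    by (rule tendsto_eq_intros filterlim_fst filterlim_snd refl | simp)+
  show "((\<lambda>x. fst x * snd x) \<longlongrightarrow> a * b) (nhds a \<times>\<^sub>F nhds b)"
  proof (rule tendsto_vabs_bound[OF _ 0])
    fix x :: "'a \<times> 'a"
    have *: "fst x * snd x - a * b
        = (fst x - a) * (snd x - b) + (fst x - a) * b + a * (snd x - b)"
      by (simp add: algebra_simps)
    have "vabs (fst x * snd x - a * b)
        \<le> vabs ((fst x - a) * (snd x - b)) + vabs ((fst x - a) * b) + vabs (a * (snd x - b))"
      unfolding * by (intro vabs_add_le) simp_all
    then show "vabs (fst x * snd x - a * b)
        \<le> dist (fst x) a * dist (snd x) b + dist (fst x) a * vabs b + vabs a * dist (snd x) b"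
      by (simp add: dist_vabs vabs_mult)
  qed
qed

lemma closed_vabs_le: "closed {x :: 'a::complete_nonarch_field. vabs x \<le> r}"
proof -
  have "{x :: 'a. vabs x \<le> r} = cball 0 r"
    by (auto simp: dist_vabs)
  then show ?thesis by simp
qed

lemma vabs_limit_le:
  assumes "X \<longlonglongrightarrow> (l :: 'a::complete_nonarch_field)" "\<And>n. vabs (X n) \<le> r"
  shows "vabs l \<le> r"
  using closed_sequentially[OF closed_vabs_le, of X r l] assms by auto

text \<open>Open balls of an ultrametric are closed: a limit is equal in size to its late approximations
  unless it is small anyway.\<close>

lemma vabs_limit_less:
  assumes "X \<longlonglongrightarrow> (l :: 'a::complete_nonarch_field)" "\<And>n. vabs (X n) < r"
  shows "vabs l < r"
proof -
  have "0 < r" using assms(2)[of 0] vabs_nonneg[of "X 0"] by linarith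
  then obtain n where "dist (X n) l < r"
    using metric_LIMSEQ_D[OF assms(1), of r] by auto
  then show ?thesis
    using vabs_diff_less[of "X n" r "X n - l"] assms(2)[of n] by (simp add: dist_vabs)
qed

lemma sums_mult_left:
  "f sums s \<Longrightarrow> (\<lambda>n. c * f n) sums (c * s :: 'a::complete_nonarch_field)"
  unfolding sums_def sum_distrib_left[symmetric] by (rule tendsto_mult_left)

lemma sums_tail:
  assumes "f sums (s :: 'a::complete_nonarch_field)"
  shows "(\<lambda>n. f (Suc n)) sums (s - f 0)"
proof -
  have "(\<lambda>n. sum f {..<Suc n} - f 0) \<longlonglongrightarrow> s - f 0"
    using assms unfolding sums_def by (intro tendsto_diff tendsto_const LIMSEQ_Suc)
  then show ?thesis
    unfolding sums_def sum.lessThan_Suc_shift by simp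
qed

text \<open>By the ultrametric inequality, \<open>X m - X n\<close> is no larger than the largest of the consecutive
  differences between them, so these need only tend to 0.\<close>

lemma Cauchy_of_vabs_Suc:
  assumes e: "\<And>n. vabs (X (Suc n) - X n :: 'a::complete_nonarch_field) \<le> e n" "e \<longlonglongrightarrow> 0"
  shows "Cauchy X"
proof (rule metric_CauchyI)
  fix d :: real assume "0 < d"
  then obtain N where N: "\<And>n. n \<ge> N \<Longrightarrow> \<bar>e n\<bar> < d"
    using LIMSEQ_D[OF e(2), of d] by auto
  have *: "vabs (X (N + k) - X N) < d" for k
  proof (induction k)
    case (Suc k)
    have "vabs (X (Suc (N + k)) - X (N + k)) < d"
      using e(1)[of "N + k"] N[of "N + k"] by linarith
    from vabs_add_less[OF this Suc] show ?case by simp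
  qed (use \<open>0 < d\<close> in simp)
  have "dist (X m) (X n) < d" if "m \<ge> N" "n \<ge> N" for m n
    using vabs_diff_less[OF *[of "m - N"] *[of "n - N"]] that by (simp add: dist_vabs)
  then show "\<exists>M. \<forall>m\<ge>M. \<forall>n\<ge>M. dist (X m) (X n) < d" by blast
qed

lemma summable_of_vabs_bound:
  assumes "\<And>n. vabs (f n :: 'a::complete_nonarch_field) \<le> e n" "e \<longlonglongrightarrow> 0"
  shows "summable f"
proof -
  have "Cauchy (\<lambda>n. sum f {..<n})"
    by (rule Cauchy_of_vabs_Suc[of _ e]) (use assms in simp_all)
  then show ?thesis
    by (simp add: Cauchy_convergent_iff summable_iff_convergent)
qed

lemma vabs_sums_le:
  assumes "f sums (s :: 'a::complete_nonarch_field)" "\<And>n. vabs (f n) \<le> r"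
  shows "vabs s \<le> r"
proof (rule vabs_limit_le)
  show "(\<lambda>n. sum f {..<n}) \<longlonglongrightarrow> s" using assms(1) by (simp add: sums_def)
  have "0 \<le> r" using assms(2)[of 0] vabs_nonneg[of "f 0"] by linarith
  then show "vabs (sum f {..<n}) \<le> r" for n
    using assms(2) by (intro vabs_sum_le) auto
qed

lemma vabs_sums_less:
  assumes "f sums (s :: 'a::complete_nonarch_field)" "\<And>n. vabs (f n) < r"
  shows "vabs s < r"
proof (rule vabs_limit_less)
  show "(\<lambda>n. sum f {..<n}) \<longlonglongrightarrow> s" using assms(1) by (simp add: sums_def)
  have "0 < r" using assms(2)[of 0] vabs_nonneg[of "f 0"] by linarith
  then show "vabs (sum f {..<n}) < r" for n
    using assms(2) by (intro vabs_sum_less) auto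
qed

section \<open>The p-adic numbers inside the field\<close>

lemma closed_Qp: "closed (Qp :: 'a::complete_nonarch_field set)"
  by (simp add: Qp_def)

lemma Rats_subset_Qp: "\<rat> \<subseteq> (Qp :: 'a::complete_nonarch_field set)"
  by (simp add: Qp_def closure_subset)

lemma of_nat_in_Qp [simp]: "of_nat n \<in> (Qp :: 'a::complete_nonarch_field set)"
  using Rats_subset_Qp by auto

lemma numeral_in_Qp [simp]: "numeral n \<in> (Qp :: 'a::complete_nonarch_field set)"
  using Rats_subset_Qp by auto

lemma zero_in_Qp [simp]: "0 \<in> (Qp :: 'a::complete_nonarch_field set)"
  using Rats_subset_Qp by auto

lemma one_in_Qp [simp]: "1 \<in> (Qp :: 'a::complete_nonarch_field set)"
  using Rats_subset_Qp by auto

lemma Qp_add: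
  assumes "x \<in> Qp" "(y :: 'a::complete_nonarch_field) \<in> Qp"
  shows "x + y \<in> Qp"
proof -
  obtain X Y where X: "\<And>n. X n \<in> \<rat>" "X \<longlonglongrightarrow> x" and Y: "\<And>n. Y n \<in> \<rat>" "Y \<longlonglongrightarrow> y"
    using assms unfolding Qp_def closure_sequential by blast
  have "(\<lambda>n. X n + Y n) \<longlonglongrightarrow> x + y" "\<And>n. X n + Y n \<in> \<rat>"
    using X Y by (auto intro: tendsto_add)
  then show ?thesis
    unfolding Qp_def closure_sequential by (intro exI[of _ "\<lambda>n. X n + Y n"]) simp
qed

lemma Qp_mult:
  assumes "x \<in> Qp" "(y :: 'a::complete_nonarch_field) \<in> Qp"
  shows "x * y \<in> Qp"
proof -
  obtain X Y where X: "\<And>n. X n \<in> \<rat>" "X \<longlonglongrightarrow> x" and Y: "\<And>n. Y n \<in> \<rat>" "Y \<longlonglongrightarrow> y"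
    using assms unfolding Qp_def closure_sequential by blast
  have "(\<lambda>n. X n * Y n) \<longlonglongrightarrow> x * y" "\<And>n. X n * Y n \<in> \<rat>"
    using X Y by (auto intro: tendsto_mult)
  then show ?thesis
    unfolding Qp_def closure_sequential by (intro exI[of _ "\<lambda>n. X n * Y n"]) simp
qed

lemma Qp_minus: "x \<in> Qp \<Longrightarrow> - x \<in> (Qp :: 'a::complete_nonarch_field set)"
proof -
  have "- 1 \<in> (Qp :: 'a set)" using Rats_subset_Qp by auto
  then show "x \<in> Qp \<Longrightarrow> - x \<in> (Qp :: 'a set)" using Qp_mult[of "- 1" x] by simp
qed

lemma Qp_diff: "x \<in> Qp \<Longrightarrow> y \<in> Qp \<Longrightarrow> x - y \<in> (Qp :: 'a::complete_nonarch_field set)"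
  using Qp_add[of x "- y"] Qp_minus[of y] by simp

lemma Qp_inverse:
  assumes "x \<in> (Qp :: 'a::complete_nonarch_field set)"
  shows "inverse x \<in> Qp"
proof (cases "x = 0")
  case False
  show ?thesis
    unfolding Qp_def closure_approachable
  proof (intro allI impI)
    fix e :: real assume "0 < e"
    define d where "d = min (vabs x) (e * vabs x * vabs x)"
    have "0 < vabs x" using False vabs_nonneg[of x] by (simp add: less_le)
    then have "0 < d" using \<open>0 < e\<close> by (simp add: d_def)
    then obtain y where y: "y \<in> \<rat>" "vabs (y - x) < d"
      using assms unfolding Qp_def closure_approachable by (auto simp: dist_vabs)
    have yx: "vabs y = vabs x" by (rule vabs_eq_of_close) (use y in \<open>simp add: d_def\<close>)
    then have "y \<noteq> 0" using \<open>0 < vabs x\<close> by auto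
    then have "inverse y - inverse x = (x - y) / (x * y)"
      using False by (simp add: field_simps)
    then have "dist (inverse y) (inverse x) = vabs (y - x) / (vabs x * vabs x)"
      by (simp add: dist_vabs vabs_divide vabs_mult yx vabs_minus_commute)
    also have "\<dots> < e"
      using y(2) \<open>0 < vabs x\<close> by (simp add: d_def field_simps)
    finally show "\<exists>y\<in>\<rat>. dist y (inverse x) < e" using y(1) by auto
  qed
qed simp

lemma Qp_divide: "x \<in> Qp \<Longrightarrow> y \<in> Qp \<Longrightarrow> x / y \<in> (Qp :: 'a::complete_nonarch_field set)"
  using Qp_mult[of x "inverse y"] Qp_inverse[of y] by (simp add: divide_inverse)

lemma Qp_sum: "(\<And>i. i \<in> S \<Longrightarrow> f i \<in> Qp) \<Longrightarrow> sum f S \<in> (Qp :: 'a::complete_nonarch_field set)"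
  by (induction S rule: infinite_finite_induct) (auto intro: Qp_add)

lemma Qp_prod: "(\<And>i. i \<in> S \<Longrightarrow> f i \<in> Qp) \<Longrightarrow> prod f S \<in> (Qp :: 'a::complete_nonarch_field set)"
  by (induction S rule: infinite_finite_induct) (auto intro: Qp_mult)

lemma Qp_power: "x \<in> Qp \<Longrightarrow> x ^ n \<in> (Qp :: 'a::complete_nonarch_field set)"
  by (induction n) (auto intro: Qp_mult)

lemma Qp_fact [simp]: "fact n \<in> (Qp :: 'a::complete_nonarch_field set)"
  using of_nat_in_Qp[of "fact n"] by simp

lemma closed_Zp: "closed (Zp :: 'a::complete_nonarch_field set)"
proof -
  have *: "Zp = Qp \<inter> {x :: 'a. vabs x \<le> 1}" by (auto simp: Zp_def)
  show ?thesis unfolding * by (intro closed_Int closed_Qp closed_vabs_le)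
qed

lemma Zp_add: "x \<in> Zp \<Longrightarrow> y \<in> Zp \<Longrightarrow> x + y \<in> (Zp :: 'a::complete_nonarch_field set)"
  by (auto simp: Zp_def intro: Qp_add vabs_add_le)

lemma Zp_mult: "x \<in> Zp \<Longrightarrow> y \<in> Zp \<Longrightarrow> x * y \<in> (Zp :: 'a::complete_nonarch_field set)"
  by (auto simp: Zp_def intro: Qp_mult vabs_mult_le1)

lemma Zp_diff: "x \<in> Zp \<Longrightarrow> y \<in> Zp \<Longrightarrow> x - y \<in> (Zp :: 'a::complete_nonarch_field set)"
  by (auto simp: Zp_def intro: Qp_diff vabs_diff_le)

lemma Zp_divide_unit:
  "x \<in> Zp \<Longrightarrow> y \<in> Zp \<Longrightarrow> vabs y = 1 \<Longrightarrow> x / y \<in> (Zp :: 'a::complete_nonarch_field set)"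
  by (auto simp: Zp_def vabs_divide intro: Qp_divide)

lemma vabs_of_nat_le1: "vabs (of_nat n :: 'a::complete_nonarch_field) \<le> 1"
  by (induction n) (auto intro: vabs_add_le)

lemma vabs_of_int_le1: "vabs (of_int n :: 'a::complete_nonarch_field) \<le> 1"
  by (cases n) (use vabs_of_nat_le1 in \<open>auto simp del: of_nat_Suc\<close>)

lemma vabs_numeral_le1: "vabs (numeral n :: 'a::complete_nonarch_field) \<le> 1"
  using vabs_of_nat_le1[of "numeral n"] by simp

lemma of_nat_in_Zp [simp]: "of_nat n \<in> (Zp :: 'a::complete_nonarch_field set)"
  by (simp add: Zp_def vabs_of_nat_le1)

lemma numeral_in_Zp [simp]: "numeral n \<in> (Zp :: 'a::complete_nonarch_field set)"
  by (simp add: Zp_def vabs_numeral_le1)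

lemma zero_one_in_Zp [simp]:
  "0 \<in> (Zp :: 'a::complete_nonarch_field set)" "1 \<in> (Zp :: 'a::complete_nonarch_field set)"
  by (simp_all add: Zp_def)

section \<open>The p-adic absolute value\<close>

locale padic =
  fixes p :: nat and T :: "'a::complete_nonarch_field itself"
  assumes prime_p: "prime p" and vabs_p: "vabs (of_nat p :: 'a) = 1 / real p"
begin

lemma p_gt_1: "real p > 1"
  using prime_gt_1_nat[OF prime_p] by simp

lemma inverse_p_less_1: "1 / real p < 1"
  using p_gt_1 by simp

text \<open>By Bezout, \<open>n\<close> is invertible modulo \<open>p\<close>, and \<open>p\<close> is small.\<close>

lemma vabs_of_int_unit:
  assumes "\<not> int p dvd n"
  shows "vabs (of_int n :: 'a) = 1"
proof -
  have "coprime (int p) n"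
    using prime_p assms by (simp add: prime_imp_coprime)
  then obtain u v where "u * int p + v * n = 1"
    using bezout_int[of "int p" n] by (auto simp: coprime_iff_gcd_eq_1)
  then have "of_int (u * int p + v * n) = (1 :: 'a)" by simp
  then have eq: "of_int v * of_int n = 1 - of_int u * (of_nat p :: 'a)"
    by (simp add: algebra_simps)
  have "vabs (of_int u * (of_nat p :: 'a)) < 1"
    using vabs_mult_le[OF vabs_of_int_le1[of u, where ?'a = 'a], of "of_nat p" "1 / real p"]
      vabs_p inverse_p_less_1 by simp
  then have "vabs (of_int v * of_int n :: 'a) = 1"
    using vabs_eq_of_close[of "of_int v * of_int n" "1 :: 'a"] by (simp add: eq)
  then have "1 \<le> vabs (of_int n :: 'a)"
    using mult_right_mono[OF vabs_of_int_le1[of v, where ?'a = 'a] vabs_nonneg[of "of_int n :: 'a"]]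
    by (simp add: vabs_mult)
  then show ?thesis using vabs_of_int_le1[of n, where ?'a = 'a] by simp
qed

lemma vabs_of_nat_unit: "\<not> p dvd n \<Longrightarrow> vabs (of_nat n :: 'a) = 1"
  using vabs_of_int_unit[of "int n"] by simp

lemma vabs_of_nat_dvd:
  assumes "p dvd n"
  shows "vabs (of_nat n :: 'a) \<le> 1 / real p"
proof -
  obtain m where "n = p * m" using assms ..
  then show ?thesis
    using vabs_mult_le1[of "of_nat p :: 'a" "1 / real p" "of_nat m"] by (simp add: vabs_p vabs_of_nat_le1)
qed

text \<open>The power of \<open>p\<close> that divides \<open>m\<close> is at most \<open>m\<close>.\<close>

lemma vabs_of_nat_lower:
  assumes "0 < m"
  shows "1 / real m \<le> vabs (of_nat m :: 'a)"
proof -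
  obtain u where u: "m = p ^ multiplicity p m * u" "\<not> p dvd u"
    using multiplicity_decompose'[of m p] assms prime_p not_prime_unit by blast
  let ?k = "multiplicity p m"
  have "vabs (of_nat m :: 'a) = (1 / real p) ^ ?k * vabs (of_nat u :: 'a)"
    by (subst u(1)) (simp add: vabs_mult vabs_power vabs_p)
  then have eq: "vabs (of_nat m :: 'a) = 1 / real (p ^ ?k)"
    using vabs_of_nat_unit[OF u(2)] by (simp add: power_divide)
  have "p ^ ?k \<le> m" using assms by (simp add: dvd_imp_le multiplicity_dvd)
  then have "real (p ^ ?k) \<le> real m" by (rule of_nat_mono)
  then show ?thesis
    unfolding eq using prime_gt_0_nat[OF prime_p] assms by (intro divide_left_mono) simp_all
qed

text \<open>The natural numbers are dense in \<open>Zp\<close>: the denominator of a rational number in the unit ball is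
  prime to \<open>p\<close>, hence invertible modulo every power of \<open>p\<close>.\<close>

lemma Zp_approx_nat:
  assumes "y \<in> (Zp :: 'a set)" "0 < e"
  obtains m :: nat where "vabs (y - of_nat m) < e"
proof -
  have y: "y \<in> closure \<rat>" "vabs y \<le> 1" using assms(1) by (auto simp: Zp_def Qp_def)
  obtain r where r: "r \<in> \<rat>" "vabs (r - y) < min e 1"
    using y(1) assms(2) unfolding closure_approachable by (auto simp: dist_vabs dest: spec[of _ "min e 1"])
  have r1: "vabs r \<le> 1" using vabs_add_le[of "r - y" 1 y] r(2) y(2) by simp
  obtain a b where ab: "b > 0" "coprime a b" "r = of_int a / of_int b"
    using r(1) by (cases r rule: Rats_cases') auto
  have b: "\<not> int p dvd b"
  proof
    assume *: "int p dvd b"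
    have "\<not> int p dvd a"
      using ab(2) * prime_p by (meson coprime_common_divisor not_prime_unit prime_nat_int_transfer)
    then have "vabs (of_int a :: 'a) = 1" by (rule vabs_of_int_unit)
    moreover have "vabs (of_int b :: 'a) < 1"
    proof -
      have "p dvd nat b" using * ab(1) by (metis int_dvd_int_iff int_nat_eq order_less_imp_le)
      from vabs_of_nat_dvd[OF this] show ?thesis
        using inverse_p_less_1 ab(1) by simp
    qed
    moreover have "vabs (of_int b :: 'a) > 0" using ab(1) by (simp add: less_le)
    ultimately show False using r1 by (simp add: ab(3) vabs_divide field_simps)
  qed
  obtain k where k: "(1 / real p) ^ k < e"
    using real_arch_pow_inv[OF assms(2), of "1 / real p"] p_gt_1 by auto
  have "coprime (int p) b"
    using prime_p b by (simp add: prime_imp_coprime)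
  then have "coprime b (int p ^ k)" by (simp add: coprime_commute)
  then obtain u v where uv: "u * b + v * int p ^ k = 1"
    using bezout_int[of b "int p ^ k"] by (auto simp: coprime_iff_gcd_eq_1)
  define w where "w = a * u div int p ^ k"
  define m where "m = nat (a * u mod int p ^ k)"
  have m: "int m = a * u - w * int p ^ k"
    using prime_gt_0_nat[OF prime_p] by (simp add: m_def w_def minus_div_mult_eq_mod)
  have "of_int (u * b + v * int p ^ k) = (1 :: 'a)" by (simp only: uv of_int_1)
  then have uv': "of_int u * of_int b = 1 - of_int v * (of_nat p :: 'a) ^ k"
    by (simp add: algebra_simps)
  have "of_nat m = (of_int (a * u - w * int p ^ k) :: 'a)" by (metis m of_int_of_nat_eq)
  then have m': "of_nat m = of_int a * of_int u - of_int w * (of_nat p :: 'a) ^ k" by simp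
  have rb: "r * of_int b = of_int a" using ab(1) by (simp add: ab(3))
  have "(r - of_nat m) * of_int b
      = of_int a - of_int a * (of_int u * of_int b) + of_int (w * b) * (of_nat p :: 'a) ^ k"
    unfolding left_diff_distrib rb m' by (simp add: algebra_simps)
  also have "\<dots> = of_int (a * v + w * b) * (of_nat p :: 'a) ^ k"
    unfolding uv' by (simp add: algebra_simps)
  finally have "vabs ((r - of_nat m) * of_int b :: 'a) \<le> (1 / real p) ^ k"
    using vabs_mult_le[OF vabs_of_int_le1, of "(of_nat p :: 'a) ^ k" "(1 / real p) ^ k"]
    by (simp add: vabs_power vabs_p del: of_int_add of_int_mult)
  then have "vabs (r - of_nat m) < e"
    using k by (simp add: vabs_mult vabs_of_int_unit[OF b])
  then have "vabs (y - of_nat m) < e"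
    using vabs_diff_less[of "r - of_nat m" e "r - y"] r(2) by simp
  then show ?thesis by (rule that)
qed

text \<open>The absolute value is discrete on \<open>Zp\<close>, as a natural number of absolute value below 1 is a
  multiple of \<open>p\<close>. This is what separates solutions in \<open>Zp\<close> from solutions in the whole field:
  \<open>q - 1\<close> gets absolute value at most \<open>1 / p\<close> instead of just a strict bound by the radius of the domain.\<close>

lemma Zp_vabs_less_1:
  assumes "y \<in> (Zp :: 'a set)" "vabs y < 1"
  shows "vabs y \<le> 1 / real p"
proof -
  obtain m where m: "vabs (y - of_nat m) < 1 / real p"
    using Zp_approx_nat[OF assms(1), of "1 / real p"] p_gt_1 by auto
  moreover have "1 / real p < 1" using p_gt_1 by simp
  ultimately have "vabs (of_nat m :: 'a) < 1"
    using vabs_diff_less[of y 1 "y - of_nat m"] assms(2) by simp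
  then have "vabs (of_nat m :: 'a) \<le> 1 / real p"
    using vabs_of_nat_unit[of m] vabs_of_nat_dvd[of m] by fastforce
  then show ?thesis
    using vabs_add_le[of "y - of_nat m" "1 / real p" "of_nat m"] m by simp
qed

lemma Zp_divide_p:
  assumes "y \<in> (Zp :: 'a set)" "vabs y < 1"
  shows "y / of_nat p \<in> Zp"
  using Zp_vabs_less_1[OF assms] assms(1) p_gt_1
  by (auto simp: Zp_def vabs_divide vabs_p field_simps intro: Qp_divide)

section \<open>Size of the terms of the series\<close>

text \<open>\<open>A n x\<close> is \<open>n!\<close> times the binomial coefficient of \<open>x - 2\<close> over \<open>n\<close>, which is integral on
  \<open>Zp\<close> because the natural numbers are dense there.\<close>

lemma vabs_A_le_fact:
  assumes "x \<in> (Zp :: 'a set)"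
  shows "vabs (A n x) \<le> vabs (fact n :: 'a)"
proof -
  have pos: "0 < vabs (fact n :: 'a)" by (simp add: less_le)
  have x2: "x - 2 \<in> Zp" using assms by (simp add: Zp_diff)
  obtain m where m: "vabs (x - 2 - of_nat m) < vabs (fact n :: 'a)"
    using Zp_approx_nat[OF x2 pos] .
  have "A n x = (\<Prod>i = 0..<n. x - 2 - of_nat i)"
    unfolding A_def by (rule prod.reindex_bij_witness[of _ "\<lambda>i. i + 2" "\<lambda>k. k - 2"])
      (auto simp: of_nat_diff)
  moreover have "(\<Prod>i = 0..<n. of_nat m - of_nat i) = fact n * (of_nat (m choose n) :: 'a)"
    by (simp add: binomial_gbinomial gbinomial_mult_fact)
  moreover have "vabs ((\<Prod>i = 0..<n. x - 2 - of_nat i) - (\<Prod>i = 0..<n. of_nat m - of_nat i))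
      \<le> vabs (x - 2 - of_nat m)"
  proof (rule vabs_prod_diff_le)
    show "vabs (x - 2 - of_nat i) \<le> 1" for i
      using x2 by (auto simp: Zp_def vabs_of_nat_le1 intro!: vabs_diff_le[of "x - 2" 1])
    show "vabs (of_nat m - of_nat i :: 'a) \<le> 1" for i
      by (intro vabs_diff_le vabs_of_nat_le1)
    have "x - 2 - of_nat i - (of_nat m - of_nat i) = x - 2 - of_nat m" for i
      by (simp add: algebra_simps)
    then show "vabs (x - 2 - of_nat i - (of_nat m - of_nat i)) \<le> vabs (x - 2 - of_nat m)" for i
      by (simp only: order_refl)
  qed simp_all
  moreover have "vabs (fact n * of_nat (m choose n) :: 'a) \<le> vabs (fact n :: 'a)"
    by (rule vabs_mult_le1) (simp_all add: vabs_of_nat_le1)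
  ultimately show ?thesis
    using vabs_add_le[of "A n x - fact n * of_nat (m choose n)" _ "fact n * of_nat (m choose n)"] m
    by simp
qed

text \<open>The binomial coefficient cancels \<open>n!\<close> and leaves only the two factors by which
  \<open>(n + 2)!\<close> exceeds it. Their inverses grow so slowly that for \<open>x\<close> in
  \<open>Zp\<close> the series converges for all \<open>t\<close> in the open unit ball.\<close>

lemma vabs_term_le:
  assumes "x \<in> (Zp :: 'a set)"
  shows "vabs (A n x / fact (n + 2) * t ^ n)
    \<le> vabs t ^ n / vabs (of_nat ((n + 1) * (n + 2)) :: 'a)"
proof -
  have "fact (n + 2) = (of_nat ((n + 1) * (n + 2)) * fact n :: 'a)"
    by (simp add: algebra_simps)
  then have "vabs (A n x / fact (n + 2) * t ^ n)
      = (vabs (A n x) / vabs (fact n :: 'a)) * (vabs t ^ n / vabs (of_nat ((n + 1) * (n + 2)) :: 'a))"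
    by (simp only: vabs_divide vabs_mult vabs_power) simp
  also have "\<dots> \<le> 1 * (vabs t ^ n / vabs (of_nat ((n + 1) * (n + 2)) :: 'a))"
    using vabs_A_le_fact[OF assms, of n]
    by (intro mult_right_mono) (auto simp: divide_le_eq_1 less_le)
  finally show ?thesis by simp
qed

text \<open>At most one of two consecutive numbers is divisible by \<open>p\<close>, so the bound for a single
  number serves for the product.\<close>

lemma vabs_consecutive_lower:
  "1 / real (n + 2) \<le> vabs (of_nat ((n + 1) * (n + 2)) :: 'a)"
proof (cases "p dvd n + 1")
  case True
  have "\<not> p dvd n + 2"
  proof
    assume "p dvd n + 2"
    from dvd_diff_nat[OF this True] show False using prime_p by simp
  qed
  then have "vabs (of_nat (n + 2) :: 'a) = 1" by (rule vabs_of_nat_unit)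
  moreover have "1 / real (n + 2) \<le> 1 / real (n + 1)" by (simp add: field_simps)
  ultimately show ?thesis
    using vabs_of_nat_lower[of "n + 1"] by (simp only: of_nat_mult vabs_mult) simp
next
  case False
  then have "vabs (of_nat (n + 1) :: 'a) = 1" by (rule vabs_of_nat_unit)
  then show ?thesis
    using vabs_of_nat_lower[of "n + 2"] by (simp only: of_nat_mult vabs_mult) simp
qed

lemma vabs_term_le_linear:
  assumes "x \<in> (Zp :: 'a set)"
  shows "vabs (A n x / fact (n + 2) * t ^ n) \<le> real (n + 2) * vabs t ^ n"
proof -
  have "vabs t ^ n / vabs (of_nat ((n + 1) * (n + 2)) :: 'a) \<le> vabs t ^ n / (1 / real (n + 2))"
  proof (rule divide_left_mono[OF vabs_consecutive_lower])
    have "0 < 1 / real (n + 2)" by simp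
    then show "0 < vabs (of_nat ((n + 1) * (n + 2)) :: 'a) * (1 / real (n + 2))"
      using vabs_consecutive_lower[of n] by (intro mult_pos_pos) linarith+
  qed simp
  then show ?thesis
    using vabs_term_le[OF assms, of n t] by (simp add: mult.commute)
qed

lemma g_sums:
  assumes "x \<in> (Zp :: 'a set)" "vabs t < 1"
  shows "(\<lambda>n. A n x / fact (n + 2) * t ^ n) sums g x (1 + t)"
proof -
  have "(\<lambda>n. real n * vabs t ^ n + 2 * vabs t ^ n) \<longlonglongrightarrow> 0 + 2 * 0"
    using assms(2) by (intro tendsto_add tendsto_mult tendsto_const LIMSEQ_power_zero
      powser_times_n_limit_0[of "vabs t", simplified]) auto
  then have "(\<lambda>n. real (n + 2) * vabs t ^ n) \<longlonglongrightarrow> 0"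
    by (simp add: algebra_simps)
  then have "summable (\<lambda>n. A n x / fact (n + 2) * t ^ n)"
    by (rule summable_of_vabs_bound[OF vabs_term_le_linear[OF assms(1)]])
  then show ?thesis by (simp add: g_def summable_sums)
qed

text \<open>The term with index 0 is \<open>1 / 2\<close>; if it strictly dominates all others, the sum has its absolute
  value.\<close>

lemma g_nonzero:
  assumes "x \<in> (Zp :: 'a set)" "vabs t < 1"
    and small: "\<And>n. 0 < n \<Longrightarrow> vabs (A n x / fact (n + 2) * t ^ n) < vabs (1 / 2 :: 'a)"
  shows "g x (1 + t) \<noteq> 0"
proof
  assume 0: "g x (1 + t) = 0"
  have A0: "A 0 x / fact (0 + 2) * t ^ 0 = (1 / 2 :: 'a)" by (simp add: A_def)
  have "(\<lambda>n. A (Suc n) x / fact (Suc n + 2) * t ^ Suc n) sums (g x (1 + t) - 1 / 2)"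
    using sums_tail[OF g_sums[OF assms(1,2)]] unfolding A0 .
  then have "vabs (g x (1 + t) - 1 / 2) < vabs (1 / 2 :: 'a)"
    by (rule vabs_sums_less) (rule small, simp)
  then show False by (simp add: 0)
qed

section \<open>Where there are no solutions\<close>

text \<open>For \<open>p \<ge> 5\<close>, \<open>\<bar>t\<bar> \<le> 1 / p\<close> makes every term after the first less than 1 in size. For \<open>p = 2\<close>
  the domain has radius \<open>1 / 2\<close>, hence \<open>\<bar>t\<bar> \<le> 1 / 4\<close>, and the first term has size 2. The prime 3
  escapes because \<open>t / 6\<close>, from the term with index 1, can be a unit.\<close>

lemma M_Zp_empty:
  assumes "p \<noteq> 3"
  shows "M_Zp p = ({} :: ('a \<times> 'a) set)"
proof -
  have False if xq: "(x, q) \<in> (M_Zp p :: ('a \<times> 'a) set)" for x q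
  proof -
    define t where "t = q - 1"
    have x: "x \<in> Zp" and t: "t \<in> Zp" and g0: "g x (1 + t) = 0"
      and tp: "vabs t < real p powr (- 1 / (real p - 1))"
      using xq by (auto simp: M_Zp_def M_def t_def intro: Zp_diff)
    have "real p powr (- 1 / (real p - 1)) < 1"
      using p_gt_1 by (simp add: powr_less_one)
    then have t1: "vabs t < 1" using tp by simp
    have "g x (1 + t) \<noteq> 0"
    proof (rule g_nonzero[OF x t1])
      fix n :: nat assume n: "0 < n"
      note le = vabs_term_le_linear[OF x, of n t]
      show "vabs (A n x / fact (n + 2) * t ^ n) < vabs (1 / 2 :: 'a)"
      proof (cases "p = 2")
        case True
        have v2: "vabs (2 :: 'a) = 1 / 2" using vabs_p True by simp
        have "vabs t < 1 / 2"
          using tp True by (simp add: powr_minus_divide)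
        then have "vabs (t / 2) < 1" by (simp add: vabs_divide v2)
        moreover have "t / 2 \<in> Zp" using Zp_divide_p[OF t t1] True by simp
        ultimately have "vabs (t / 2) \<le> 1 / 2" using Zp_vabs_less_1[of "t / 2"] True by simp
        then have "vabs t \<le> 1 / 4" by (simp add: vabs_divide v2)
        then have "vabs t ^ n \<le> (1 / 4) ^ n" by (intro power_mono) auto
        then have "real (n + 2) * vabs t ^ n \<le> real (n + 2) * (1 / 4) ^ n"
          by (intro mult_left_mono) auto
        also have "\<dots> < 2"
        proof -
          have "real (n + 2) < 2 * 4 ^ n"
            using n by (induction n rule: nat_induct_non_zero) auto
          then show ?thesis by (simp add: power_divide field_simps)
        qed
        finally have "real (n + 2) * vabs t ^ n < 2" .
        then show ?thesis using le by (simp add: vabs_divide v2)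
      next
        case False
        have "p \<noteq> 4"
        proof
          assume "p = 4"
          moreover from this have "2 dvd p" by simp
          ultimately have "(2 :: nat) = 4" using prime_p primes_dvd_imp_eq two_is_prime_nat by metis
          then show False by simp
        qed
        then have p5: "5 \<le> p" using False assms prime_ge_2_nat[OF prime_p] by linarith
        have "vabs (of_nat 2 :: 'a) = 1"
          by (rule vabs_of_nat_unit) (use p5 in \<open>auto dest: dvd_imp_le\<close>)
        then have v2: "vabs (2 :: 'a) = 1" by simp
        have "vabs t \<le> 1 / real p" by (rule Zp_vabs_less_1[OF t t1])
        also have "\<dots> \<le> 1 / 5" using p5 by (simp add: field_simps)
        finally have "vabs t ^ n \<le> (1 / 5) ^ n" by (intro power_mono) auto
        then have "real (n + 2) * vabs t ^ n \<le> real (n + 2) * (1 / 5) ^ n"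
          by (intro mult_left_mono) auto
        also have "\<dots> < 1"
        proof -
          have "real (n + 2) < 5 ^ n"
            using n by (induction n rule: nat_induct_non_zero) auto
          then show ?thesis by (simp add: power_divide field_simps)
        qed
        finally have "real (n + 2) * vabs t ^ n < 1" .
        then show ?thesis using le by (simp add: vabs_divide v2)
      qed
    qed
    then show False using g0 by simp
  qed
  then show ?thesis by auto
qed

end

locale padic3 = padic 3 T for T :: "'a::complete_nonarch_field itself"
begin

lemma vabs_3 [simp]: "vabs (3 :: 'a) = 1 / 3"
  using vabs_p by simp

lemma vabs_2 [simp]: "vabs (2 :: 'a) = 1"
  using vabs_of_nat_unit[of 2] by simp

lemma radius_3: "real 3 powr (- 1 / (real 3 - 1)) = 1 / sqrt 3"
  by (simp add: powr_minus_divide powr_half_sqrt)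

text \<open>The condition on \<open>x\<close> removes exactly the term with index 1 from the competition with the
  first term, and this for every \<open>t\<close> in the domain, also outside \<open>Zp\<close>. The estimate that
  is linear in \<open>n\<close> is too weak for the terms with index 1 and 2, which are treated by hand.\<close>

lemma g_nonzero_residue_2:
  assumes x: "x \<in> (Zp :: 'a set)" "vabs (x - 2) < 1" and t: "vabs t < 1 / sqrt 3"
  shows "g x (1 + t) \<noteq> 0"
proof -
  have t2: "vabs t ^ 2 < 1 / 3"
  proof -
    have "vabs t ^ 2 < (1 / sqrt 3) ^ 2" using t by (intro power_strict_mono) auto
    then show ?thesis by (simp add: power_divide)
  qed
  have t1: "vabs t < 1"
    using t2 by (smt (verit) one_le_power divide_le_eq_1_pos)
  show ?thesis
  proof (rule g_nonzero[OF x(1) t1])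
    fix n :: nat assume "0 < n"
    then consider "n = 1" | "n = 2" | "3 \<le> n" by linarith
    then have "vabs (A n x / fact (n + 2) * t ^ n) < 1"
    proof cases
      case 1
      have "x - 2 \<in> Zp" using x(1) by (simp add: Zp_diff)
      then have "vabs (x - 2) \<le> 1 / 3" using Zp_vabs_less_1[of "x - 2"] x(2) by simp
      moreover have "vabs (6 :: 'a) = 1 / 3"
      proof -
        have "(6 :: 'a) = 2 * 3" by simp
        then show ?thesis by (simp only: vabs_mult) simp
      qed
      ultimately have "vabs (A n x / fact (n + 2) * t ^ n) \<le> 1 * vabs t"
        using 1 unfolding vabs_mult
        by (intro mult_mono) (simp_all add: A_def vabs_divide)
      then show ?thesis using t1 by simp
    next
      case 2
      have "(12 :: 'a) = 2 * 2 * 3" by simp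
      then have v12: "vabs (12 :: 'a) = 1 / 3" by (simp only: vabs_mult) simp
      then show ?thesis using vabs_term_le[OF x(1), of 2 t] 2 t2 by (simp add: v12)
    next
      case 3
      have "(real (n + 2) * vabs t ^ n)\<^sup>2 = real (n + 2) ^ 2 * (vabs t ^ 2) ^ n"
        by (simp add: power_mult_distrib flip: power_mult) (simp add: mult.commute)
      also have "\<dots> \<le> real (n + 2) ^ 2 * (1 / 3) ^ n"
        using t2 by (intro mult_left_mono power_mono) auto
      also have "real (n + 2) ^ 2 < 3 ^ n"
        using 3
      proof (induction n rule: dec_induct)
        case (step n)
        have "real (Suc n + 2) ^ 2 \<le> 3 * real (n + 2) ^ 2"
          by (simp add: power2_eq_square algebra_simps)
        then show ?case using step.IH by simp
      qed simp
      then have "real (n + 2) ^ 2 * (1 / 3) ^ n < 1"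
        by (simp add: power_divide field_simps)
      finally have "(real (n + 2) * vabs t ^ n)\<^sup>2 < 1\<^sup>2" by simp
      then have "real (n + 2) * vabs t ^ n < 1"
        by (rule power_less_imp_less_base) simp
      then show ?thesis using vabs_term_le_linear[OF x(1), of n t] by linarith
    qed
    then show "vabs (A n x / fact (n + 2) * t ^ n) < vabs (1 / 2 :: 'a)"
      by (simp add: vabs_divide)
  qed
qed

section \<open>The equation for p = 3 as a contraction\<close>

lemma vabs_fact_mult3: "vabs (fact (3 * m) :: 'a) = (1 / 3) ^ m * vabs (fact m :: 'a)"
proof (induction m)
  case (Suc m)
  have "\<not> 3 dvd 3 * m + 2" "\<not> 3 dvd 3 * m + 1" by presburger+
  then have units: "vabs (of_nat (3 * m + 2) :: 'a) = 1" "vabs (of_nat (3 * m + 1) :: 'a) = 1"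
    by (blast intro: vabs_of_nat_unit)+
  have "3 * Suc m = Suc (Suc (Suc (3 * m)))" by simp
  then have "(fact (3 * Suc m) :: 'a)
      = of_nat (3 * Suc m) * (of_nat (3 * m + 2) * (of_nat (3 * m + 1) * fact (3 * m)))"
    by (simp only: fact_Suc) (simp add: algebra_simps)
  then have "vabs (fact (3 * Suc m) :: 'a) = vabs (of_nat (3 * Suc m) :: 'a) * vabs (fact (3 * m) :: 'a)"
    by (simp only: vabs_mult units)
  also have "\<dots> = (1 / 3) ^ Suc m * (vabs (of_nat (Suc m) :: 'a) * vabs (fact m :: 'a))"
    unfolding Suc.IH of_nat_mult[of 3] vabs_mult by simp
  also have "vabs (of_nat (Suc m) :: 'a) * vabs (fact m :: 'a) = vabs (fact (Suc m) :: 'a)"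
    by (simp add: vabs_mult)
  finally show ?case .
qed simp

text \<open>Legendre's bound \<open>v(m!) \<le> m / 2\<close>. In \<open>m!\<close> only the multiples of 3 count, and they contribute
  as \<open>(m div 3)!\<close> does with one more factor 3 each.\<close>

lemma vabs_fact_lower: "(1 / sqrt 3) ^ m \<le> vabs (fact m :: 'a)"
proof (induction m rule: less_induct)
  case (less m)
  define k where "k = m div 3"
  have eq: "vabs (fact m :: 'a) = (1 / 3) ^ k * vabs (fact k :: 'a)"
  proof -
    have units: "vabs (of_nat (3 * k + 2) :: 'a) = 1" "vabs (of_nat (3 * k + 1) :: 'a) = 1"
      by (rule vabs_of_nat_unit, presburger)+
    consider "m = 3 * k" | "m = Suc (3 * k)" | "m = Suc (Suc (3 * k))"
      unfolding k_def by linarith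
    then have "vabs (fact m :: 'a) = vabs (fact (3 * k) :: 'a)"
    proof cases
      case 2
      have "(fact m :: 'a) = of_nat (3 * k + 1) * fact (3 * k)" by (simp add: 2)
      then show ?thesis by (simp only: vabs_mult units)
    next
      case 3
      have "(fact m :: 'a) = of_nat (3 * k + 2) * (of_nat (3 * k + 1) * fact (3 * k))"
        by (simp add: 3 algebra_simps)
      then show ?thesis by (simp only: vabs_mult units)
    qed simp
    then show ?thesis by (simp only: vabs_fact_mult3)
  qed
  show ?case
  proof (cases "m = 0")
    case False
    have "(1 / sqrt 3) ^ m \<le> (1 / sqrt 3) ^ (3 * k)"
      by (rule power_decreasing) (auto simp: k_def)
    also have "\<dots> = ((1 / sqrt 3) ^ 2) ^ k * (1 / sqrt 3) ^ k"
      by (simp flip: power_mult power_add)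
    also have "\<dots> = (1 / 3) ^ k * (1 / sqrt 3) ^ k"
      by (simp add: power_divide)
    also have "\<dots> \<le> (1 / 3) ^ k * vabs (fact k :: 'a)"
      by (rule mult_left_mono[OF less.IH]) (use False in \<open>auto simp: k_def\<close>)
    finally show ?thesis unfolding eq .
  qed simp
qed

text \<open>With \<open>t = 3 * s\<close> the coefficients of \<open>A n x * s ^ n\<close> in \<open>2 * g x (1 + 3 * s)\<close> are
  \<open>2 * 3 ^ n / (n + 2)!\<close>. The terms with index 0 and 1 are \<open>1\<close> and \<open>(x - 2) * s\<close>; all later coefficients
  are divisible by 3. They are collected in a remainder \<open>R\<close>, and the coefficients below index 2 are set to 0 so
  that its series has the same index as the original one.\<close>

definition \<rho> :: "nat \<Rightarrow> 'a" where
  "\<rho> n = (if n < 2 then 0 else 2 * 3 ^ n / fact (n + 2))"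

lemma vabs_\<rho>_decay: "vabs (\<rho> n) \<le> 3 * (1 / sqrt 3) ^ n"
proof (cases "n < 2")
  case False
  have "(1 / 3) ^ n = ((1 / sqrt 3) ^ 2) ^ n" by (simp add: power_divide)
  also have "\<dots> = (1 / sqrt 3) ^ n * (1 / sqrt 3) ^ n"
    by (simp add: mult_2 flip: power_mult power_add)
  also have "\<dots> = 3 * (1 / sqrt 3) ^ n * (1 / sqrt 3) ^ (n + 2)"
  proof -
    have "(1 / sqrt 3) ^ 2 = (1 / 3 :: real)" by (simp add: power_divide)
    then show ?thesis unfolding power_add by simp
  qed
  finally have *: "(1 / 3) ^ n = 3 * (1 / sqrt 3) ^ n * (1 / sqrt 3) ^ (n + 2)" .
  have "(1 / 3) ^ n \<le> 3 * (1 / sqrt 3) ^ n * vabs (fact (n + 2) :: 'a)"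
    unfolding * by (rule mult_left_mono[OF vabs_fact_lower]) simp
  moreover have "0 < vabs (fact (n + 2) :: 'a)" by (simp only: vabs_pos_iff fact_nonzero not_False_eq_True)
  moreover have "vabs (\<rho> n) = (1 / 3) ^ n / vabs (fact (n + 2) :: 'a)"
    using False by (simp add: \<rho>_def vabs_divide vabs_mult vabs_power del: fact_Suc add_2_eq_Suc')
  ultimately show ?thesis by (simp only: pos_divide_le_eq)
qed (simp add: \<rho>_def)

text \<open>Legendre's bound alone gives \<open>1 / 3\<close> from index 4 on.\<close>

lemma vabs_\<rho>_le: "vabs (\<rho> n) \<le> 1 / 3"
proof -
  consider "n < 2" | "n = 2" | "n = 3" | "4 \<le> n" by linarith
  then show ?thesis
  proof cases
    case 2
    have "\<rho> n = 3 / (2 * 2)" by (simp add: 2 \<rho>_def fact_numeral)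
    then show ?thesis by (simp only: vabs_divide vabs_mult) simp
  next
    case 3
    have "vabs (of_nat 20 :: 'a) = 1" by (rule vabs_of_nat_unit) simp
    then have 20: "vabs (20 :: 'a) = 1" by simp
    have "\<rho> n = 3 * 3 / 20" by (simp add: 3 \<rho>_def fact_numeral)
    then show ?thesis by (simp only: vabs_divide vabs_mult 20) simp
  next
    case 4
    have "vabs (\<rho> n) \<le> 3 * (1 / sqrt 3) ^ n" by (rule vabs_\<rho>_decay)
    also have "\<dots> \<le> 3 * (1 / sqrt 3) ^ 4"
      using 4 by (intro mult_left_mono power_decreasing) auto
    also have "(1 / sqrt 3) ^ 4 = ((1 / sqrt 3) ^ 2) ^ 2" by (simp flip: power_mult)
    also have "\<dots> = (1 / 9 :: real)" by (simp add: power_divide)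
    finally show ?thesis by simp
  qed (simp add: \<rho>_def)
qed

definition R :: "'a \<Rightarrow> 'a \<Rightarrow> 'a" where
  "R x s = 2 * g x (1 + 3 * s) - 1 - (x - 2) * s"

lemma g_eq_0_iff: "g x (1 + 3 * s) = 0 \<longleftrightarrow> 1 + (x - 2) * s + R x s = 0"
  by (simp add: R_def)

lemma R_sums:
  assumes x: "x \<in> (Zp :: 'a set)" and s: "s \<in> Zp"
  shows "(\<lambda>n. \<rho> n * A n x * s ^ n) sums R x s"
proof -
  have "vabs (3 * s) < 1"
    using s by (simp add: vabs_mult Zp_def)
  from sums_mult_left[OF g_sums[OF x this], of 2]
  have 1: "(\<lambda>n. 2 * (A n x / fact (n + 2) * (3 * s) ^ n)) sums (2 * g x (1 + 3 * s))" .
  let ?h = "\<lambda>n::nat. if n = 0 then - 1 else if n = 1 then - (x - 2) * s else 0"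
  have "?h sums (\<Sum>n\<in>{0, 1}. ?h n)"
    by (rule sums_finite) auto
  then have 2: "?h sums (- 1 - (x - 2) * s)" by (simp add: algebra_simps)
  have "2 * (A n x / fact (n + 2) * (3 * s) ^ n) + ?h n = \<rho> n * A n x * s ^ n" for n
  proof -
    consider "n = 0" | "n = 1" | "2 \<le> n" by linarith
    then show ?thesis
    proof cases
      case 2
      have "2 * ((x - 2) / 6 * (3 * s)) = (x - 2) * s" by (simp add: field_simps)
      then show ?thesis using 2 by (simp add: \<rho>_def A_def fact_numeral algebra_simps)
    qed (simp_all add: \<rho>_def A_def power_mult_distrib del: fact_Suc add_2_eq_Suc')
  qed
  then show ?thesis
    using sums_add[OF 1 2] by (simp add: R_def algebra_simps)
qed

lemma vabs_A_le1:
  assumes "x \<in> (Zp :: 'a set)"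
  shows "vabs (A n x) \<le> 1"
  unfolding A_def using assms
  by (intro vabs_prod_le1 vabs_diff_le vabs_of_nat_le1) (simp add: Zp_def)

lemma vabs_A_diff_le:
  assumes "x \<in> (Zp :: 'a set)" "y \<in> Zp"
  shows "vabs (A n x - A n y) \<le> vabs (x - y)"
  unfolding A_def
proof (rule vabs_prod_diff_le)
  show "vabs (x - of_nat k) \<le> 1" "vabs (y - of_nat k) \<le> 1" for k
    using assms by (auto simp: Zp_def intro!: vabs_diff_le vabs_of_nat_le1)
qed simp_all

text \<open>This is the heart of the matter: the equation \<open>1 + (x - 2) * s + R x s = 0\<close> is a
  perturbation of the hyperbola \<open>(x - 2) * s = - 1\<close> by a function that is contracting in both variables.\<close>

lemma R_lipschitz:
  assumes Zp: "x \<in> (Zp :: 'a set)" "s \<in> Zp" "x' \<in> Zp" "s' \<in> Zp"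
    and d: "vabs (x - x') \<le> d" "vabs (s - s') \<le> d"
  shows "vabs (R x s - R x' s') \<le> d / 3"
proof (rule vabs_sums_le)
  show "(\<lambda>n. \<rho> n * A n x * s ^ n + (- 1) * (\<rho> n * A n x' * s' ^ n)) sums (R x s - R x' s')"
    using sums_add[OF R_sums[OF Zp(1,2)] sums_mult_left[OF R_sums[OF Zp(3,4)], of "- 1"]] by simp
  fix n
  have "vabs (A n x * s ^ n - A n x' * s' ^ n) \<le> d"
  proof (rule vabs_mult_diff_le)
    show "vabs (A n x') \<le> 1" "vabs (s ^ n) \<le> 1"
      using Zp by (auto simp: vabs_A_le1 Zp_def intro: vabs_power_le1)
    show "vabs (A n x - A n x') \<le> d"
      using vabs_A_diff_le[OF Zp(1,3)] d(1) order_trans by blast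
    show "vabs (s ^ n - s' ^ n) \<le> d"
      using vabs_power_diff_le[of s s' n] Zp d(2) by (simp add: Zp_def)
  qed
  from vabs_mult_le[OF vabs_\<rho>_le this]
  show "vabs (\<rho> n * A n x * s ^ n + (- 1) * (\<rho> n * A n x' * s' ^ n)) \<le> d / 3"
    by (simp add: algebra_simps)
qed

lemma \<rho>_in_Qp: "\<rho> n \<in> Qp"
  by (auto simp: \<rho>_def intro!: Qp_divide Qp_mult Qp_power simp del: fact_Suc add_2_eq_Suc')

lemma R_bound:
  assumes Zp: "x \<in> (Zp :: 'a set)" "s \<in> Zp"
  shows "R x s \<in> Zp" "vabs (R x s) \<le> 1 / 3"
proof -
  show le: "vabs (R x s) \<le> 1 / 3"
  proof (rule vabs_sums_le[OF R_sums[OF Zp]])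
    fix n
    have "vabs (A n x * s ^ n) \<le> 1"
      using Zp by (auto simp: Zp_def intro!: vabs_mult_le1 vabs_A_le1 vabs_power_le1)
    then show "vabs (\<rho> n * A n x * s ^ n) \<le> 1 / 3"
      using vabs_mult_le1[OF vabs_\<rho>_le] by (simp add: mult.assoc)
  qed
  have "R x s \<in> Qp"
  proof (rule closed_sequentially[OF closed_Qp])
    show "(\<lambda>N. \<Sum>n<N. \<rho> n * A n x * s ^ n) \<longlonglongrightarrow> R x s"
      using R_sums[OF Zp] by (simp add: sums_def)
    show "(\<Sum>n<N. \<rho> n * A n x * s ^ n) \<in> Qp" for N
      using Zp \<rho>_in_Qp unfolding A_def
      by (intro Qp_sum Qp_mult Qp_prod Qp_power Qp_diff) (auto simp: Zp_def)
  qed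
  then show "R x s \<in> Zp" using le by (simp add: Zp_def)
qed

lemma zero_units:
  assumes Zp: "x \<in> (Zp :: 'a set)" "s \<in> Zp" and zero: "g x (1 + 3 * s) = 0"
  shows "vabs (1 + (x - 2) * s) \<le> 1 / 3" "vabs (x - 2) = 1" "vabs s = 1"
proof -
  have "1 + (x - 2) * s = - R x s"
    using zero unfolding g_eq_0_iff by (simp add: eq_neg_iff_add_eq_0)
  then show le: "vabs (1 + (x - 2) * s) \<le> 1 / 3" using R_bound(2)[OF Zp] by simp
  have "vabs ((x - 2) * s - (- 1)) < vabs (- 1 :: 'a)" using le by (simp add: add.commute)
  from vabs_eq_of_close[OF this] have 1: "vabs (x - 2) * vabs s = 1" by (simp add: vabs_mult)
  have "x - 2 \<in> Zp" using Zp by (simp add: Zp_diff)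
  then have "vabs (x - 2) \<le> 1" "vabs s \<le> 1" using Zp by (auto simp: Zp_def)
  then show "vabs (x - 2) = 1" "vabs s = 1"
    using 1 mult_left_le[of "vabs s" "vabs (x - 2)"] mult_left_le[of "vabs (x - 2)" "vabs s"]
    by (auto simp: mult.commute)
qed

text \<open>On the hyperbola \<open>s\<close> and \<open>x - 2\<close> are units, inverse up to sign, so differences of \<open>s\<close> and of \<open>x\<close> have
  equal size. The perturbation changes the relation between the two differences by at most a third of the
  larger one, which cannot make up for unequal sizes. In particular each coordinate of a zero determines the
  other.\<close>

lemma zeros_isometric:
  assumes Zp: "x \<in> (Zp :: 'a set)" "s \<in> Zp" "x' \<in> Zp" "s' \<in> Zp"
    and zero: "g x (1 + 3 * s) = 0" "g x' (1 + 3 * s') = 0"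
  shows "vabs (s - s') = vabs (x - x')"
proof (rule ccontr)
  assume neq: "vabs (s - s') \<noteq> vabs (x - x')"
  define d where "d = max (vabs (s - s')) (vabs (x - x'))"
  have "R x s = - (1 + (x - 2) * s)" "R x' s' = - (1 + (x' - 2) * s')"
    using zero unfolding g_eq_0_iff by (simp_all only: add_eq_0_iff)
  then have "R x' s' - R x s = - (1 + (x' - 2) * s') - - (1 + (x - 2) * s)"
    by (simp only:)
  then have "(x - 2) * (s - s') + (x - x') * s' = R x' s' - R x s"
    by (simp add: algebra_simps)
  then have *: "vabs ((x - 2) * (s - s') + (x - x') * s') \<le> d / 3"
    using R_lipschitz[OF Zp, of d] by (simp add: d_def vabs_minus_commute)
  have "vabs ((x - 2) * (s - s')) = vabs (s - s')" "vabs ((x - x') * s') = vabs (x - x')"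
    using zero_units[OF Zp(1,2) zero(1)] zero_units[OF Zp(3,4) zero(2)] by (simp_all add: vabs_mult)
  moreover have "0 < d" using neq vabs_nonneg[of "s - s'"] vabs_nonneg[of "x - x'"]
    unfolding d_def by linarith
  ultimately show False
    using neq * vabs_eq_of_close[of "(x - 2) * (s - s')" "- ((x - x') * s')"]
      vabs_eq_of_close[of "- ((x - x') * s')" "(x - 2) * (s - s')"]
      vabs_minus_commute[of "(x - 2) * (s - s')" "- ((x - x') * s')"]
    unfolding d_def by (simp add: max_def split: if_splits)
qed

text \<open>The equation, solved for one variable outside the remainder, is a fixed point equation for
  a contraction; likewise for the other variable.\<close>

lemma exists_s:
  assumes x: "x \<in> (Zp :: 'a set)" "vabs (x - 2) = 1"
  obtains s where "s \<in> Zp" "g x (1 + 3 * s) = 0"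
proof -
  let ?f = "\<lambda>s. - (1 + R x s) / (x - 2)"
  have x2: "x - 2 \<in> Zp" using x by (simp add: Zp_diff)
  have "\<exists>!s\<in>Zp. ?f s = s"
  proof (rule Banach_fix)
    show "complete (Zp :: 'a set)" using closed_Zp by (simp add: complete_eq_closed)
    show "Zp \<noteq> ({} :: 'a set)" using zero_one_in_Zp by blast
    show "?f ` Zp \<subseteq> Zp"
    proof clarify
      fix s :: 'a assume s: "s \<in> Zp"
      have "0 - (1 + R x s) \<in> Zp" by (intro Zp_diff Zp_add R_bound x s) simp_all
      then show "?f s \<in> Zp" using Zp_divide_unit[OF _ x2 x(2)] by simp
    qed
    fix s s' :: 'a assume s: "s \<in> Zp" "s' \<in> Zp"
    have "?f s - ?f s' = (R x s' - R x s) / (x - 2)"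
      by (simp flip: diff_divide_distrib)
    then show "dist (?f s) (?f s') \<le> 1 / 3 * dist s s'"
      using R_lipschitz[of x s' x s "vabs (s' - s)"] s x
      by (simp add: dist_vabs vabs_divide vabs_minus_commute)
  qed simp_all
  then obtain s where s: "s \<in> Zp" "?f s = s" by blast
  have "x - 2 \<noteq> 0" using x(2) by auto
  then have "- (1 + R x s) = (x - 2) * s"
    using s(2) by (simp add: divide_eq_eq mult.commute)
  then have "g x (1 + 3 * s) = 0"
    unfolding g_eq_0_iff by (simp add: algebra_simps eq_neg_iff_add_eq_0)
  then show ?thesis using that s(1) by blast
qed

lemma exists_x:
  assumes s: "s \<in> (Zp :: 'a set)" "vabs s = 1"
  obtains x where "x \<in> Zp" "g x (1 + 3 * s) = 0"
proof -
  let ?f = "\<lambda>x. 2 - (1 + R x s) / s"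
  have "\<exists>!x\<in>Zp. ?f x = x"
  proof (rule Banach_fix)
    show "complete (Zp :: 'a set)" using closed_Zp by (simp add: complete_eq_closed)
    show "Zp \<noteq> ({} :: 'a set)" using zero_one_in_Zp by blast
    show "?f ` Zp \<subseteq> Zp"
      using s by (auto intro!: Zp_diff Zp_divide_unit Zp_add R_bound)
    fix x x' :: 'a assume x: "x \<in> Zp" "x' \<in> Zp"
    have "?f x - ?f x' = (R x' s - R x s) / s"
      by (simp add: diff_divide_distrib add_divide_distrib)
    then show "dist (?f x) (?f x') \<le> 1 / 3 * dist x x'"
      using R_lipschitz[of x' s x s "vabs (x' - x)"] s x
      by (simp add: dist_vabs vabs_divide vabs_minus_commute)
  qed simp_all
  then obtain x where x: "x \<in> Zp" "?f x = x" by blast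
  have "s \<noteq> 0" using s(2) by auto
  have "x - 2 = - ((1 + R x s) / s)" using x(2) by (simp add: algebra_simps)
  then have "(x - 2) * s = - (1 + R x s)" using \<open>s \<noteq> 0\<close> by simp
  then have "g x (1 + 3 * s) = 0"
    unfolding g_eq_0_iff by (simp add: algebra_simps eq_neg_iff_add_eq_0)
  then show ?thesis using that x(1) by blast
qed

end

section \<open>Fixed points that depend analytically on a parameter\<close>

text \<open>Analyticity is a statement about coefficients, and the supremum of a function on \<open>Zp\<close> does not
  bound its coefficients (\<open>u ^ 3 - u\<close> is divisible by 3 at all 3-adic integers). So the
  contraction is iterated on polynomials in the parameter \<open>u\<close>, measured by the Gauss norm, the maximal size of
  a coefficient.\<close>

definition coeffs_le :: "real \<Rightarrow> 'a::complete_nonarch_field poly \<Rightarrow> bool" where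
  "coeffs_le r f \<longleftrightarrow> (\<forall>i. coeff f i \<in> Qp \<and> vabs (coeff f i) \<le> r)"

lemma coeffs_le_mono: "coeffs_le r f \<Longrightarrow> r \<le> r' \<Longrightarrow> coeffs_le r' f"
  unfolding coeffs_le_def by (meson order_trans)

lemma coeffs_le_0: "0 \<le> r \<Longrightarrow> coeffs_le r 0"
  by (simp add: coeffs_le_def)

lemma coeffs_le_pCons:
  "c \<in> Qp \<Longrightarrow> vabs c \<le> r \<Longrightarrow> coeffs_le r f \<Longrightarrow> coeffs_le r (pCons c f)"
  by (auto simp: coeffs_le_def coeff_pCons split: nat.split)

lemma coeffs_le_add: "coeffs_le r f \<Longrightarrow> coeffs_le r h \<Longrightarrow> coeffs_le r (f + h)"
  by (auto simp: coeffs_le_def intro: Qp_add vabs_add_le)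

lemma coeffs_le_sum:
  assumes "\<And>i. i \<in> S \<Longrightarrow> coeffs_le r (f i)" "0 \<le> r"
  shows "coeffs_le r (sum f S)"
  using assms by (induction S rule: infinite_finite_induct) (auto intro: coeffs_le_add coeffs_le_0)

lemma coeffs_le_mult:
  assumes "coeffs_le r f" "coeffs_le r' h"
  shows "coeffs_le (r * r') (f * h)"
  unfolding coeffs_le_def
proof (intro allI conjI)
  fix i
  show "coeff (f * h) i \<in> Qp"
    unfolding coeff_mult using assms by (auto simp: coeffs_le_def intro!: Qp_sum Qp_mult)
  have "0 \<le> r * r'"
    using assms vabs_nonneg unfolding coeffs_le_def by (meson mult_nonneg_nonneg order_trans)
  then show "vabs (coeff (f * h) i) \<le> r * r'"
    unfolding coeff_mult using assms by (auto simp: coeffs_le_def intro!: vabs_sum_le vabs_mult_le)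
qed

lemma coeffs_le_mult1: "coeffs_le r f \<Longrightarrow> coeffs_le 1 h \<Longrightarrow> coeffs_le r (f * h)"
  using coeffs_le_mult[of r f 1 h] by simp

lemma coeffs_le_smult:
  "c \<in> Qp \<Longrightarrow> vabs c \<le> r \<Longrightarrow> coeffs_le 1 f \<Longrightarrow> coeffs_le r (smult c f)"
  by (auto simp: coeffs_le_def intro: Qp_mult vabs_mult_le1)

lemma coeffs_le_1: "coeffs_le 1 1"
  by (auto simp: coeffs_le_def coeff_1)

lemma coeffs_le_prod: "(\<And>i. i \<in> S \<Longrightarrow> coeffs_le 1 (f i)) \<Longrightarrow> coeffs_le 1 (prod f S)"
  by (induction S rule: infinite_finite_induct) (auto intro: coeffs_le_mult1 coeffs_le_1)

lemma coeffs_le_power: "coeffs_le 1 f \<Longrightarrow> coeffs_le 1 (f ^ n)"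
  by (induction n) (auto intro: coeffs_le_mult1 coeffs_le_1)

lemma coeffs_le_power_diff:
  assumes "coeffs_le 1 f" "coeffs_le 1 h" "coeffs_le e (f - h)" "0 \<le> e"
  shows "coeffs_le e (f ^ n - h ^ n)"
proof (induction n)
  case (Suc n)
  have "f ^ Suc n - h ^ Suc n = (f - h) * f ^ n + (f ^ n - h ^ n) * h"
    by (simp add: algebra_simps)
  then show ?case
    using assms Suc by (auto intro!: coeffs_le_add coeffs_le_mult1 coeffs_le_power)
qed (use assms in \<open>simp add: coeffs_le_0\<close>)

lemma vabs_poly_le:
  assumes "coeffs_le r f" "vabs u \<le> 1" "0 \<le> r"
  shows "vabs (poly f u) \<le> r"
  unfolding poly_altdef using assms
  by (auto simp: coeffs_le_def intro!: vabs_sum_le vabs_mult_le1 vabs_power_le1)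

text \<open>The equation is \<open>s = b + (\<Sum>n. \<beta>\<^sub>n(u) * s ^ n)\<close>. The polynomials
  \<open>S (j + 1) = b + (\<Sum>n<j. \<beta>\<^sub>n * S j ^ n)\<close> approach the solution at the rate \<open>C * r ^ j\<close> both
  coefficientwise and pointwise, since the contraction factor \<open>\<theta>\<close> and the decay of the \<open>\<beta>\<^sub>n\<close>,
  which controls the truncation of the series at step \<open>j\<close>, are both bounded by \<open>r\<close>. The limits of the
  coefficients form the required power series, because both errors are uniform.\<close>

theorem analytic_fixed_point:
  fixes \<beta> :: "nat \<Rightarrow> 'a::complete_nonarch_field poly" and s :: "'a \<Rightarrow> 'a"
  assumes const: "1 \<le> C" "0 \<le> \<theta>" "\<theta> \<le> r" "r < 1"
    and b: "b \<in> Zp"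
    and \<beta>: "\<And>n. coeffs_le \<theta> (\<beta> n)" "\<And>n. coeffs_le (C * r ^ Suc n) (\<beta> n)"
    and U: "\<And>u. u \<in> U \<Longrightarrow> vabs u \<le> 1"
    and s: "\<And>u. u \<in> U \<Longrightarrow> vabs (s u) \<le> 1"
    and fixed: "\<And>u. u \<in> U \<Longrightarrow> (\<lambda>n. poly (\<beta> n) u * s u ^ n) sums (s u - b)"
  obtains c where "\<And>k. c k \<in> Qp" "\<And>u. u \<in> U \<Longrightarrow> (\<lambda>k. c k * u ^ k) sums s u"
proof -
  define S where "S = rec_nat 0 (\<lambda>j f. [:b:] + (\<Sum>n<j. \<beta> n * f ^ n))"
  have S0: "S 0 = 0" and SSuc: "S (Suc j) = [:b:] + (\<Sum>n<j. \<beta> n * S j ^ n)" for j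
    by (simp_all add: S_def)
  have r0: "0 \<le> r" and C0: "0 \<le> C" using const by linarith+
  have e0: "0 \<le> C * r ^ j" for j using r0 C0 by simp
  have b': "coeffs_le 1 [:b:]"
    using b by (auto simp: Zp_def intro!: coeffs_le_pCons coeffs_le_0)
  have S1: "coeffs_le 1 (S j)" for j
  proof (induction j)
    case (Suc j)
    have "coeffs_le 1 (\<beta> n)" for n
      by (rule coeffs_le_mono[OF \<beta>(1)]) (use const in linarith)
    then show ?case
      unfolding SSuc using Suc b'
      by (intro coeffs_le_add coeffs_le_sum coeffs_le_mult1 coeffs_le_power) auto
  qed (simp add: S0 coeffs_le_0)
  have contract: "\<theta> * (C * r ^ j) \<le> C * r ^ Suc j" for j
    using mult_right_mono[OF const(3) e0[of j]] by (simp add: mult_ac)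
  have S_diff: "coeffs_le (C * r ^ j) (S (Suc j) - S j)" for j
  proof (induction j)
    case 0
    show ?case using coeffs_le_mono[OF b' const(1)] by (simp add: S0 SSuc)
  next
    case (Suc j)
    have "S (Suc (Suc j)) - S (Suc j)
        = (\<Sum>n<Suc j. \<beta> n * S (Suc j) ^ n) - (\<Sum>n<j. \<beta> n * S j ^ n)"
      using arg_cong2[of _ _ _ _ "(-)", OF SSuc[of "Suc j"] SSuc[of j]]
      by (simp only: add_diff_cancel_left)
    then have "S (Suc (Suc j)) - S (Suc j)
        = (\<Sum>n<j. \<beta> n * (S (Suc j) ^ n - S j ^ n)) + \<beta> j * S (Suc j) ^ j"
      by (simp add: right_diff_distrib sum_subtractf)
    moreover have "coeffs_le (C * r ^ Suc j) (\<beta> n * (S (Suc j) ^ n - S j ^ n))" for n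
      by (rule coeffs_le_mono[OF coeffs_le_mult[OF \<beta>(1)] contract])
        (intro coeffs_le_power_diff S1 Suc e0)
    moreover have "coeffs_le (C * r ^ Suc j) (\<beta> j * S (Suc j) ^ j)"
      by (intro coeffs_le_mult1 coeffs_le_power S1 \<beta>(2))
    ultimately show ?case
      using e0[of "Suc j"] by (simp only:) (intro coeffs_le_add coeffs_le_sum)
  qed
  have small: "(\<lambda>j. C * r ^ j) \<longlonglongrightarrow> 0"
    using tendsto_mult[OF tendsto_const[of C] LIMSEQ_power_zero[of r]] r0 const by simp
  define c where "c k = lim (\<lambda>j. coeff (S j) k)" for k
  have step: "vabs (coeff (S (Suc j)) k - coeff (S j) k) \<le> C * r ^ j" for j k
    using S_diff[of j] unfolding coeffs_le_def coeff_diff by blast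
  have lim: "(\<lambda>j. coeff (S j) k) \<longlonglongrightarrow> c k" for k
  proof -
    have "Cauchy (\<lambda>j. coeff (S j) k)" by (rule Cauchy_of_vabs_Suc[OF step small])
    then show ?thesis by (simp add: c_def Cauchy_convergent_iff convergent_LIMSEQ_iff)
  qed
  have c_Qp: "c k \<in> Qp" for k
    by (rule closed_sequentially[OF closed_Qp _ lim]) (use S1 in \<open>auto simp: coeffs_le_def\<close>)
  have c_near: "vabs (c k - coeff (S j) k) \<le> C * r ^ j" for j k
  proof (rule vabs_limit_le)
    show "(\<lambda>m. coeff (S (m + j)) k - coeff (S j) k) \<longlonglongrightarrow> c k - coeff (S j) k"
      by (intro tendsto_diff tendsto_const LIMSEQ_ignore_initial_segment lim)
    show "vabs (coeff (S (m + j)) k - coeff (S j) k) \<le> C * r ^ j" for m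
    proof (induction m)
      case (Suc m)
      have "vabs (coeff (S (Suc (m + j))) k - coeff (S (m + j)) k) \<le> C * r ^ j"
        by (rule order_trans[OF step]) (use r0 C0 const in \<open>intro mult_left_mono power_decreasing, auto\<close>)
      from vabs_add_le[OF this Suc] show ?case by simp
    qed (simp add: e0)
  qed
  have s_near: "vabs (s u - poly (S j) u) \<le> C * r ^ j" if u: "u \<in> U" for u j
  proof (induction j)
    case 0
    show ?case using s[OF u] const(1) by (simp add: S0)
  next
    case (Suc j)
    let ?h = "\<lambda>n. if n < j then - (poly (\<beta> n) u * poly (S j) u ^ n) else 0"
    have "?h sums (\<Sum>n<j. ?h n)" by (rule sums_finite) auto
    also have "(\<Sum>n<j. ?h n) = b - poly (S (Suc j)) u"
      by (simp add: SSuc poly_sum sum_negf)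
    finally have "(\<lambda>n. poly (\<beta> n) u * s u ^ n + ?h n) sums (s u - b + (b - poly (S (Suc j)) u))"
      by (rule sums_add[OF fixed[OF u]])
    then have sums: "(\<lambda>n. poly (\<beta> n) u * s u ^ n + ?h n) sums (s u - poly (S (Suc j)) u)"
      by simp
    show ?case
    proof (rule vabs_sums_le[OF sums])
      fix n
      show "vabs (poly (\<beta> n) u * s u ^ n + ?h n) \<le> C * r ^ Suc j"
      proof (cases "n < j")
        case True
        have "vabs (poly (S j) u) \<le> 1" by (rule vabs_poly_le[OF S1 U[OF u]]) simp
        then have "vabs (s u ^ n - poly (S j) u ^ n) \<le> C * r ^ j"
          using order_trans[OF vabs_power_diff_le Suc] s[OF u] by blast
        from vabs_mult_le[OF vabs_poly_le[OF \<beta>(1) U[OF u] const(2)] this]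
        have "vabs (poly (\<beta> n) u * (s u ^ n - poly (S j) u ^ n)) \<le> C * r ^ Suc j"
          using contract[of j] by (rule order_trans)
        then show ?thesis using True by (simp add: right_diff_distrib)
      next
        case False
        have "vabs (poly (\<beta> n) u * s u ^ n) \<le> C * r ^ Suc n"
          by (intro vabs_mult_le1 vabs_poly_le \<beta>(2) U[OF u] vabs_power_le1 s[OF u] e0)
        also have "\<dots> \<le> C * r ^ Suc j"
          using False r0 C0 const by (intro mult_left_mono power_decreasing) auto
        finally show ?thesis using False by simp
      qed
    qed
  qed
  have "(\<lambda>k. c k * u ^ k) sums s u" if u: "u \<in> U" for u
    unfolding sums_def
  proof (rule metric_LIMSEQ_I)
    fix e :: real assume "0 < e"
    then obtain j where j: "C * r ^ j < e"
      using LIMSEQ_D[OF small, of e] e0 by auto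
    have "dist (\<Sum>k<K. c k * u ^ k) (s u) < e" if K: "K \<ge> Suc (degree (S j))" for K
    proof -
      have "poly (S j) u = (\<Sum>k<K. coeff (S j) k * u ^ k)"
        unfolding poly_altdef using K
        by (intro sum.mono_neutral_left) (auto simp: coeff_eq_0)
      then have "(\<Sum>k<K. c k * u ^ k) - poly (S j) u = (\<Sum>k<K. (c k - coeff (S j) k) * u ^ k)"
        by (simp add: left_diff_distrib sum_subtractf)
      also have "vabs \<dots> \<le> C * r ^ j"
        by (intro vabs_sum_le vabs_mult_le1 c_near vabs_power_le1 U[OF u] e0)
      finally have "vabs ((\<Sum>k<K. c k * u ^ k) - s u) \<le> C * r ^ j"
        using vabs_diff_le[of "(\<Sum>k<K. c k * u ^ k) - poly (S j) u" "C * r ^ j" "s u - poly (S j) u"]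
          s_near[OF u, of j] by simp
      then show ?thesis using j by (simp add: dist_vabs)
    qed
    then show "\<exists>K0. \<forall>K\<ge>K0. dist (\<Sum>k<K. c k * u ^ k) (s u) < e" by blast
  qed
  then show ?thesis using that c_Qp by blast
qed

context padic3
begin

text \<open>With \<open>x = a + 3 * u\<close> the leading part of the equation is \<open>1 + (3 * (\<delta> + u) - \<sigma>) * s\<close>, where
  \<open>\<sigma>\<close> is the sign with \<open>\<sigma> \<equiv> 2 - a\<close> modulo 3. Multiplication by \<open>\<sigma>\<close> isolates \<open>s\<close>:
  \<open>s = \<sigma> + 3 * \<sigma> * (\<delta> + u) * s + \<sigma> * R x s\<close>, a fixed point equation whose coefficients are
  polynomials in \<open>u\<close> divisible by 3. A power series in \<open>u\<close> is one in \<open>x - a\<close>, with coefficients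
  multiplied by powers of \<open>1 / 3\<close>.\<close>

lemma zero_function_analytic:
  fixes s :: "'a \<Rightarrow> 'a"
  assumes a: "a \<in> Zp" and \<delta>: "\<delta> \<in> Zp" and \<sigma>: "\<sigma> \<in> Zp" "\<sigma> * \<sigma> = 1" and a\<delta>: "a - 2 = 3 * \<delta> - \<sigma>"
    and s: "\<And>x. x \<in> Zp_ball a 1 \<Longrightarrow> s x \<in> Zp"
    and zero: "\<And>x. x \<in> Zp_ball a 1 \<Longrightarrow> g x (1 + 3 * s x) = 0"
  shows "analytic_on_Zp_ball (\<lambda>x. 1 + 3 * s x) a 1"
proof -
  define \<beta> where "\<beta> n = smult (\<sigma> * \<rho> n) (\<Prod>k=2..n+1. [:a - of_nat k, 3:])
    + (if n = 1 then smult (3 * \<sigma>) [:\<delta>, 1:] else 0)" for n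
  have Qp: "a \<in> Qp" "\<delta> \<in> Qp" "\<sigma> \<in> Qp" and le1: "vabs a \<le> 1" "vabs \<delta> \<le> 1" "vabs \<sigma> \<le> 1"
    using a \<delta> \<sigma> by (auto simp: Zp_def)
  have prod: "coeffs_le 1 (\<Prod>k=2..n+1. [:a - of_nat k, 3:])" for n
    using Qp le1
    by (intro coeffs_le_prod coeffs_le_pCons coeffs_le_0 Qp_diff vabs_diff_le vabs_of_nat_le1) auto
  have lin: "coeffs_le 1 [:\<delta>, 1:]"
    using Qp le1 by (intro coeffs_le_pCons coeffs_le_0) auto
  have \<sigma>\<rho>: "\<sigma> * \<rho> n \<in> Qp" "vabs (\<sigma> * \<rho> n) \<le> vabs (\<rho> n)" for n
    using Qp \<rho>_in_Qp le1 vabs_mult_le1[of "\<rho> n" "vabs (\<rho> n)" \<sigma>]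
    by (auto intro: Qp_mult simp: mult.commute)
  have 3: "3 * \<sigma> \<in> Qp" "vabs (3 * \<sigma>) \<le> 1 / 3"
    using Qp le1 by (auto intro: Qp_mult simp: vabs_mult)
  have \<beta>1: "coeffs_le (1 / 3) (\<beta> n)" for n
    unfolding \<beta>_def
  proof (rule coeffs_le_add)
    show "coeffs_le (1 / 3) (smult (\<sigma> * \<rho> n) (\<Prod>k=2..n+1. [:a - of_nat k, 3:]))"
      by (rule coeffs_le_smult[OF \<sigma>\<rho>(1) order_trans[OF \<sigma>\<rho>(2) vabs_\<rho>_le] prod])
    show "coeffs_le (1 / 3) (if n = 1 then smult (3 * \<sigma>) [:\<delta>, 1:] else 0)"
      using coeffs_le_smult[OF 3 lin] by (simp add: coeffs_le_0 del: smult_pCons)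
  qed
  \<comment> \<open>the constant 6 comes from \<open>3 = 3 * sqrt 3 * (1 / sqrt 3) \<le> 6 * (1 / sqrt 3)\<close>\<close>
  have sqrt3: "sqrt 3 \<le> 2" by (rule real_le_lsqrt) auto
  have dec: "3 * (1 / sqrt 3) ^ n \<le> 6 * (1 / sqrt 3) ^ Suc n" for n
  proof -
    have "6 * (1 / sqrt 3) ^ Suc n = 3 * (2 / sqrt 3) * (1 / sqrt 3) ^ n" by simp
    moreover have "1 \<le> 2 / sqrt 3" using sqrt3 by simp
    ultimately show ?thesis
      by (simp only:) (intro mult_right_mono, simp_all add: field_simps)
  qed
  have \<beta>2: "coeffs_le (6 * (1 / sqrt 3) ^ Suc n) (\<beta> n)" for n
  proof (cases "n = 1")
    case True
    have "(1 / 3 :: real) \<le> 6 * (1 / sqrt 3) ^ Suc n"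
      using True by (simp add: power2_eq_square[symmetric] power_divide)
    then show ?thesis by (rule coeffs_le_mono[OF \<beta>1])
  next
    case False
    have "vabs (\<sigma> * \<rho> n) \<le> 6 * (1 / sqrt 3) ^ Suc n"
      using \<sigma>\<rho>(2)[of n] vabs_\<rho>_decay[of n] dec[of n] by linarith
    then show ?thesis
      using False \<sigma>\<rho>(1)[of n] prod[of n] unfolding \<beta>_def by (simp add: coeffs_le_smult)
  qed
  have ball: "a + 3 * u \<in> Zp_ball a 1" if "u \<in> Zp" for u
    using that a
    by (auto simp: Zp_ball_def Zp_def vabs_mult intro!: Zp_add Zp_mult Qp_add Qp_mult vabs_add_le)
  have fixed: "(\<lambda>n. poly (\<beta> n) u * s (a + 3 * u) ^ n) sums (s (a + 3 * u) - \<sigma>)" if u: "u \<in> Zp" for u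
  proof -
    define x where "x = a + 3 * u"
    have x: "x \<in> Zp_ball a 1" "x \<in> Zp" using ball[OF u] by (auto simp: x_def Zp_ball_def)
    have x2: "x - 2 = 3 * (\<delta> + u) - \<sigma>" using a\<delta> by (simp add: x_def algebra_simps)
    have "R x (s x) = - (1 + (x - 2) * s x)"
      using zero[OF x(1)] unfolding g_eq_0_iff by (simp only: add_eq_0_iff)
    then have "R x (s x) = \<sigma> * s x - 1 - 3 * (\<delta> + u) * s x"
      unfolding x2 by (simp add: algebra_simps)
    then have "\<sigma> * R x (s x) + 3 * \<sigma> * (\<delta> + u) * s x = \<sigma> * \<sigma> * s x - \<sigma>"
      by (simp only:) (simp add: algebra_simps)
    then have eq: "\<sigma> * R x (s x) + 3 * \<sigma> * (\<delta> + u) * s x = s x - \<sigma>"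
      by (simp add: \<sigma>(2))
    let ?h = "\<lambda>n::nat. if n = 1 then 3 * \<sigma> * (\<delta> + u) * s x else 0"
    have "?h sums (\<Sum>n\<in>{1}. ?h n)" by (rule sums_finite) auto
    then have "?h sums (3 * \<sigma> * (\<delta> + u) * s x)" by simp
    from sums_add[OF sums_mult_left[OF R_sums[OF x(2) s[OF x(1)]], of \<sigma>] this]
    have "(\<lambda>n. \<sigma> * (\<rho> n * A n x * s x ^ n) + ?h n) sums (s x - \<sigma>)"
      unfolding eq .
    moreover have "\<sigma> * (\<rho> n * A n x * s x ^ n) + ?h n = poly (\<beta> n) u * s x ^ n" for n
      by (simp add: \<beta>_def poly_prod A_def x_def algebra_simps)
    ultimately show ?thesis by (simp add: x_def)
  qed
  obtain c where c: "\<And>k. c k \<in> Qp" "\<And>u. u \<in> Zp \<Longrightarrow> (\<lambda>k. c k * u ^ k) sums s (a + 3 * u)"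
  proof (rule analytic_fixed_point[where C = 6 and \<theta> = "1 / 3" and r = "1 / sqrt 3" and b = \<sigma>
      and \<beta> = \<beta> and U = Zp and s = "\<lambda>u. s (a + 3 * u)"])
    show "1 / 3 \<le> 1 / sqrt (3 :: real)" using sqrt3 by (simp add: field_simps)
    show "vabs (s (a + 3 * u)) \<le> 1" if "u \<in> Zp" for u
      using s[OF ball[OF that]] by (simp add: Zp_def)
  qed (use \<beta>1 \<beta>2 fixed \<sigma> in \<open>auto simp: Zp_def\<close>)
  define d where "d k = (if k = 0 then 1 else 0) + 3 * (c k / 3 ^ k)" for k
  have "(\<lambda>k. d k * (x - a) ^ k) sums (1 + 3 * s x)" if x: "x \<in> Zp_ball a 1" for x
  proof -
    define u where "u = (x - a) / 3"
    have "x - a \<in> Zp" "vabs (x - a) < 1" using x a by (auto simp: Zp_ball_def Zp_diff)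
    then have "u \<in> Zp" using Zp_divide_p[of "x - a"] by (simp add: u_def)
    moreover have "3 * u = x - a"
      unfolding u_def times_divide_eq_right by (rule nonzero_mult_div_cancel_left) simp
    then have "x = a + 3 * u" by simp
    ultimately have "(\<lambda>k. c k * u ^ k) sums s x" using c(2) by blast
    moreover have "(\<lambda>k::nat. if k = 0 then 1 else 0) sums (\<Sum>k\<in>{0::nat}. if k = 0 then 1 else 0 :: 'a)"
      by (rule sums_finite) auto
    ultimately have "(\<lambda>k. (if k = 0 then 1 else 0) + 3 * (c k * u ^ k)) sums (1 + 3 * s x)"
      using sums_add sums_mult_left by fastforce
    moreover have "(if k = 0 then 1 else 0) + 3 * (c k * u ^ k) = d k * (x - a) ^ k" for k
      by (simp add: d_def u_def power_divide algebra_simps)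
    ultimately show ?thesis by simp
  qed
  moreover have "d k \<in> Qp" for k
    unfolding d_def using c(1) by (auto intro!: Qp_add Qp_mult Qp_divide Qp_power)
  ultimately show ?thesis unfolding analytic_on_Zp_ball_def by blast
qed

section \<open>The solutions for p = 3\<close>

lemma vabs_3_mult: "vabs (3 * y) = vabs (y :: 'a) / 3"
  by (simp add: vabs_mult)

lemma Zp_residue:
  assumes "x \<in> (Zp :: 'a set)"
  shows "vabs x < 1 \<or> vabs (x - 1) < 1 \<or> vabs (x - 2) < 1"
proof -
  obtain m where m: "vabs (x - of_nat m) < 1"
    using Zp_approx_nat[OF assms, of 1] by auto
  have "of_nat m = (of_nat (3 * (m div 3)) + of_nat (m mod 3) :: 'a)"
    by (simp only: mult_div_mod_eq flip: of_nat_add)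
  then have "x - of_nat (m mod 3) = (x - of_nat m) + of_nat (3 * (m div 3))"
    by simp
  moreover have "vabs (of_nat (3 * (m div 3)) :: 'a) < 1"
    using vabs_of_nat_dvd[of "3 * (m div 3)"] by simp
  ultimately have "vabs (x - of_nat (m mod 3)) < 1"
    using vabs_add_less[OF m] by (simp only:)
  moreover have "m mod 3 = 0 \<or> m mod 3 = 1 \<or> m mod 3 = 2" by linarith
  ultimately show ?thesis by auto
qed

lemma M_Zp_iff:
  "(x, q) \<in> M_Zp 3 \<longleftrightarrow> x \<in> Zp \<and> q \<in> (Zp :: 'a set) \<and> vabs (q - 1) < 1 / sqrt 3 \<and> g x q = 0"
  unfolding M_Zp_def M_def radius_3 by (auto simp: Zp_def)

lemma sqrt3_bound: "1 / 3 < 1 / sqrt 3"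
proof -
  have "sqrt 3 < 3" by (rule real_less_lsqrt) auto
  then show ?thesis by (simp add: field_simps)
qed

text \<open>Modulo 3 the equation reads \<open>(x - 2) * s = - 1\<close>, so \<open>x\<close> in the residue classes 1 and 0
  corresponds to \<open>s\<close> in the classes 1 and 2. The class 2 of \<open>x\<close> has no counterpart.\<close>

lemma zero_residues:
  assumes Zp: "x \<in> Zp" "s \<in> (Zp :: 'a set)" and zero: "g x (1 + 3 * s) = 0"
  shows "vabs (x - 1) < 1 \<longleftrightarrow> vabs (s - 1) < (1 :: real)" "vabs x < 1 \<longleftrightarrow> vabs (s - 2) < 1"
proof -
  have le: "vabs (1 + (x - 2) * s) < 1" and u: "vabs (x - 2) = 1" "vabs s = 1"
    using zero_units[OF assms] by auto
  have 1: "vabs ((x - 1) * s) = vabs (x - 1)" and 2: "vabs (x * s) = vabs x"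
    using u by (simp_all add: vabs_mult)
  have "s - 1 = (x - 1) * s - (1 + (x - 2) * s)" "(x - 1) * s = (s - 1) + (1 + (x - 2) * s)"
    by (simp_all add: algebra_simps)
  then show "vabs (x - 1) < 1 \<longleftrightarrow> vabs (s - 1) < (1 :: real)"
    using vabs_diff_less[of "(x - 1) * s" 1 "1 + (x - 2) * s"]
      vabs_add_less[of "s - 1" 1 "1 + (x - 2) * s"] le 1 by auto
  have 3: "vabs (3 :: 'a) < 1" by simp
  have "vabs (2 * (s - 2)) = vabs (s - 2)" by (simp only: vabs_mult vabs_2 mult_1_left)
  moreover have "2 * (s - 2) = x * s - (1 + (x - 2) * s) - 3"
    "x * s = 2 * (s - 2) + (1 + (x - 2) * s) + 3"
    by (simp_all add: algebra_simps)
  ultimately show "vabs x < 1 \<longleftrightarrow> vabs (s - 2) < 1"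
    using vabs_diff_less[OF vabs_diff_less[of "x * s" 1 "1 + (x - 2) * s"] 3]
      vabs_add_less[OF vabs_add_less[of "2 * (s - 2)" 1 "1 + (x - 2) * s"] 3] le 2 by auto
qed

definition zero_of :: "'a \<Rightarrow> 'a" where
  "zero_of x = (SOME s. s \<in> Zp \<and> g x (1 + 3 * s) = 0)"

lemma zero_of:
  assumes "x \<in> Zp_ball 1 1 \<union> Zp_ball 0 1"
  shows "zero_of x \<in> Zp" "g x (1 + 3 * zero_of x) = 0"
proof -
  have x: "x \<in> Zp" using assms by (auto simp: Zp_ball_def)
  have "vabs ((x - 2) - (- 1)) < vabs (- 1 :: 'a) \<or> vabs ((x - 2) - (- 2)) < vabs (- 2 :: 'a)"
    using assms by (auto simp: Zp_ball_def)
  then have "vabs (x - 2) = vabs (- 1 :: 'a) \<or> vabs (x - 2) = vabs (- 2 :: 'a)"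
    by (elim disj_forward vabs_eq_of_close)
  then have "vabs (x - 2) = 1" by auto
  from exists_s[OF x this] obtain s where "s \<in> Zp \<and> g x (1 + 3 * s) = 0" by blast
  from someI[of "\<lambda>s. s \<in> Zp \<and> g x (1 + 3 * s) = 0", OF this]
  show "zero_of x \<in> Zp" "g x (1 + 3 * zero_of x) = 0" unfolding zero_of_def by auto
qed

definition Q :: "'a \<Rightarrow> 'a" where
  "Q x = 1 + 3 * zero_of x"

lemma Q_in_M:
  assumes "x \<in> Zp_ball 1 1 \<union> Zp_ball 0 1"
  shows "(x, Q x) \<in> M_Zp 3"
proof -
  have "vabs (3 * zero_of x) \<le> 1 / 3"
    using zero_of[OF assms] by (simp add: vabs_3_mult Zp_def)
  then have "vabs (3 * zero_of x) < 1 / sqrt 3"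
    using sqrt3_bound by linarith
  then have "vabs (Q x - 1) < 1 / sqrt 3"
    by (simp add: Q_def)
  then show ?thesis
    using zero_of[OF assms] assms
    by (auto simp: M_Zp_iff Q_def Zp_ball_def intro!: Zp_add Zp_mult)
qed

lemma Q_isometry:
  assumes "x \<in> Zp_ball 1 1 \<union> Zp_ball 0 1" "x' \<in> Zp_ball 1 1 \<union> Zp_ball 0 1"
  shows "vabs (Q x' - Q x) = vabs (x' - x) / 3"
proof -
  have "x \<in> Zp" "x' \<in> Zp" using assms by (auto simp: Zp_ball_def)
  then have "vabs (zero_of x' - zero_of x) = vabs (x' - x)"
    using zeros_isometric zero_of assms by blast
  moreover have "Q x' - Q x = 3 * (zero_of x' - zero_of x)" by (simp add: Q_def algebra_simps)
  ultimately show ?thesis by (simp only: vabs_3_mult)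
qed

lemma Q_inj: "inj_on Q (Zp_ball 1 1 \<union> Zp_ball 0 1)"
proof (rule inj_onI)
  fix x y assume xy: "x \<in> Zp_ball 1 1 \<union> Zp_ball 0 1" "y \<in> Zp_ball 1 1 \<union> Zp_ball 0 1" "Q x = Q y"
  then have "vabs (x - y) = 0" using Q_isometry[OF xy(2,1)] by simp
  then show "x = y" by simp
qed

text \<open>Surjectivity comes from solving the equation for \<open>x\<close>; that the solution is mapped back to
  the given point follows from the isometry of zeros.\<close>

lemma Q_image:
  assumes "(a, b) = (1, 1) \<or> (a, b) = (0, 2 :: 'a)"
  shows "Q ` Zp_ball a 1 = Zp_ball (1 + 3 * b) (1 / 3)"
proof
  have ab: "Zp_ball a 1 \<subseteq> Zp_ball 1 1 \<union> Zp_ball 0 1" and b: "b \<in> Zp" "vabs b = 1"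
    using assms by auto
  have residue: "vabs (x - a) < 1 \<longleftrightarrow> vabs (s - b) < 1"
      if "x \<in> Zp" "s \<in> Zp" "g x (1 + 3 * s) = 0" for x s
    using assms zero_residues[OF that] by auto
  show "Q ` Zp_ball a 1 \<subseteq> Zp_ball (1 + 3 * b) (1 / 3)"
  proof (intro image_subsetI)
    fix x assume x: "x \<in> Zp_ball a 1"
    have z: "zero_of x \<in> Zp" "g x (1 + 3 * zero_of x) = 0" using zero_of ab x by blast+
    then have "vabs (zero_of x - b) < 1" using residue[of x] x by (simp add: Zp_ball_def)
    moreover have "Q x - (1 + 3 * b) = 3 * (zero_of x - b)" by (simp add: Q_def algebra_simps)
    ultimately have "vabs (Q x - (1 + 3 * b)) < 1 / 3" by (simp only: vabs_3_mult)
    then show "Q x \<in> Zp_ball (1 + 3 * b) (1 / 3)"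
      using z(1) by (simp add: Zp_ball_def Q_def Zp_add Zp_mult)
  qed
  show "Zp_ball (1 + 3 * b) (1 / 3) \<subseteq> Q ` Zp_ball a 1"
  proof
    fix q assume q: "q \<in> Zp_ball (1 + 3 * b) (1 / 3)"
    define s where "s = (q - 1) / 3"
    have "3 * s = q - 1"
      unfolding s_def times_divide_eq_right by (rule nonzero_mult_div_cancel_left) simp
    then have qs: "q = 1 + 3 * s" by simp
    have "q - (1 + 3 * b) = 3 * (s - b)" by (simp add: qs algebra_simps)
    then have "vabs (q - (1 + 3 * b)) = vabs (s - b) / 3" by (simp only: vabs_3_mult)
    then have sb: "vabs (s - b) < 1" using q by (simp add: Zp_ball_def)
    then have s1: "vabs s = 1" using vabs_eq_of_close[of s b] b by simp
    have "q - 1 \<in> Zp" using q by (simp add: Zp_ball_def Zp_diff)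
    moreover have "vabs (q - 1) < 1" using s1 by (simp add: qs vabs_3_mult)
    ultimately have s: "s \<in> Zp" using Zp_divide_p[of "q - 1"] by (simp add: s_def)
    obtain x where x: "x \<in> Zp" "g x (1 + 3 * s) = 0" using exists_x[OF s s1] .
    then have xa: "x \<in> Zp_ball a 1" using residue[OF x(1) s x(2)] sb by (simp add: Zp_ball_def)
    then have "zero_of x \<in> Zp" "g x (1 + 3 * zero_of x) = 0" using zero_of ab by blast+
    then have "vabs (zero_of x - s) = 0" using zeros_isometric[of x "zero_of x" x s] x s by simp
    then show "q \<in> Q ` Zp_ball a 1" using xa by (auto simp: Q_def qs intro!: image_eqI[of _ _ x])
  qed
qed

lemma Q_analytic: "analytic_on_Zp_ball Q 1 1" "analytic_on_Zp_ball Q 0 1"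
  unfolding Q_def
  by (rule zero_function_analytic[of _ 0 1] zero_function_analytic[of _ "- 1" "- 1"];
      use zero_of in \<open>auto simp: Zp_def Qp_minus\<close>)+

text \<open>Here \<open>q\<close> ranges over the whole field, so \<open>s\<close> need not be integral and the equation for
  \<open>s\<close> is not available. The residue class 2 is excluded by the dominance of the first term.\<close>

lemma nontrivial_fixed_points_subset:
  "{x \<in> (Zp :: 'a set). \<exists>q. nontrivial_fixed_point 3 q x} \<subseteq> Zp_ball 1 1 \<union> Zp_ball 0 1"
proof clarify
  fix x q :: 'a assume x: "x \<in> Zp" and q: "nontrivial_fixed_point 3 q x" and n: "x \<notin> Zp_ball 0 1"
  have "vabs (q - 1) < 1 / sqrt 3" "g x q = 0"
    using q unfolding nontrivial_fixed_point_def M_def radius_3 by auto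
  then have "\<not> vabs (x - 2) < 1" using g_nonzero_residue_2[OF x, of "q - 1"] by auto
  then show "x \<in> Zp_ball 1 1" using Zp_residue[OF x] x n by (auto simp: Zp_ball_def)
qed

end

theorem corollary7:
  fixes p :: nat
  assumes "padic_complex p TYPE('a::complete_nonarch_field)"
  shows "((M_Zp p :: ('a \<times> 'a) set) \<noteq> {} \<longleftrightarrow> p = 3) \<and>
    (p = 3 \<longrightarrow>
      {x \<in> (Zp :: 'a set). \<exists>q. nontrivial_fixed_point p q x} = fst ` M_Zp p \<and>
      fst ` M_Zp p = (Zp_ball 1 1 \<union> Zp_ball 0 1 :: 'a set) \<and>
      (\<exists>Q :: 'a \<Rightarrow> 'a.
        analytic_on_Zp_ball Q 1 1 \<and>
        analytic_on_Zp_ball Q 0 1 \<and>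
        (\<forall>x \<in> Zp_ball 1 1 \<union> Zp_ball 0 1. (x, Q x) \<in> M_Zp p) \<and>
        bij_betw Q (Zp_ball 1 1 \<union> Zp_ball 0 1) (Zp_ball 4 (1/3) \<union> Zp_ball 7 (1/3)) \<and>
        bij_betw Q (Zp_ball 1 1) (Zp_ball 4 (1/3)) \<and>
        bij_betw Q (Zp_ball 0 1) (Zp_ball 7 (1/3)) \<and>
        (\<forall>x \<in> Zp_ball 1 1 \<union> Zp_ball 0 1. \<forall>x' \<in> Zp_ball 1 1 \<union> Zp_ball 0 1.
           vabs (Q x' - Q x) = vabs (x' - x) / 3)))"
proof (cases "p = 3")
  case False
  interpret padic p "TYPE('a)"
    using assms by unfold_locales (auto simp: padic_complex_def)
  show ?thesis using M_Zp_empty[OF False] False by simp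
next
  case True
  interpret padic3 "TYPE('a)"
    using assms True by unfold_locales (auto simp: padic_complex_def)
  let ?B = "Zp_ball 1 1 \<union> Zp_ball 0 1 :: 'a set"
  let ?F = "{x \<in> (Zp :: 'a set). \<exists>q. nontrivial_fixed_point 3 q x}"
  have "?B \<subseteq> fst ` M_Zp 3"
    using Q_in_M by (force intro: image_eqI[of _ fst "(x, Q x)" for x])
  moreover have "fst ` M_Zp 3 \<subseteq> ?F"
    by (auto simp: M_Zp_def nontrivial_fixed_point_def)
  ultimately have sets: "?F = fst ` M_Zp 3" "fst ` M_Zp 3 = ?B"
    using nontrivial_fixed_points_subset by blast+
  have "(1 :: 'a) \<in> ?B" by (simp add: Zp_ball_def)
  then have nonempty: "(M_Zp 3 :: ('a \<times> 'a) set) \<noteq> {}" using sets(2) by blast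
  have img: "Q ` Zp_ball 1 1 = Zp_ball 4 (1 / 3)" "Q ` Zp_ball 0 1 = Zp_ball 7 (1 / 3)"
    using Q_image[of 1 1] Q_image[of 0 2] by simp_all
  have bij: "bij_betw Q ?B (Zp_ball 4 (1 / 3) \<union> Zp_ball 7 (1 / 3))"
    "bij_betw Q (Zp_ball 1 1) (Zp_ball 4 (1 / 3))"
    "bij_betw Q (Zp_ball 0 1) (Zp_ball 7 (1 / 3))"
    unfolding bij_betw_def using Q_inj inj_on_subset[OF Q_inj] img by (auto simp: image_Un)
  show ?thesis
    unfolding True
    using nonempty sets Q_analytic Q_in_M bij Q_isometry
    by (intro conjI impI iffI exI[of _ Q]) blast+
qed

end
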